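(* Suppose $U$ is a unitary operator acting on a $d$-dimensional bipartite Hilbert space $\mathcal{H}$. Then the minimum number of experimental settings $\mu(U)$ required to verify $U$ satisfies $d\le\mu(U)\le 2d$.
   Context: A verification protocol for a unitary $U$ consists of pure product input test states and, for each output state $U|\psi_j\rangle$, a verification protocol based on nonadaptive local projective measurements; it is ordinary if each output-state verification operator has positive spectral gap (one minus its second largest eigenvalue), and $U$ is verified reliably if only the unitary channel of $U$ passes every test with certainty. One experimental setting means the preparation of a pure product input state together with one nonadaptive local projective measurement on the output state; $\mu(U)$ is the minimum number of experimental settings required to verify $U$ by ordinary protocols. *)

theory Defs
  imports "Jordan_Normal_Form.Char_Poly" "HOL-Library.Extended_Nat"
begin

definition dagger :: "complex mat \<Rightarrow> complex mat" where
  "dagger A = mat (dim_col A) (dim_row A) (\<lambda>(i,j). cnj (A $$ (j,i)))"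

definition braket :: "complex vec \<Rightarrow> complex vec \<Rightarrow> complex" where
  "braket u v = (\<Sum>i<dim_vec v. cnj (u $ i) * v $ i)"

definition unit_vec :: "nat \<Rightarrow> complex vec \<Rightarrow> bool" where
  "unit_vec n v \<longleftrightarrow> v \<in> carrier_vec n \<and> braket v v = 1"

definition ketbra :: "complex vec \<Rightarrow> complex mat" where
  "ketbra v = mat (dim_vec v) (dim_vec v) (\<lambda>(i,j). v $ i * cnj (v $ j))"

definition unitary :: "nat \<Rightarrow> complex mat \<Rightarrow> bool" where
  "unitary n U \<longleftrightarrow> U \<in> carrier_mat n n \<and> dagger U * U = 1\<^sub>m n \<and> U * dagger U = 1\<^sub>m n"

definition hermitian :: "complex mat \<Rightarrow> bool" where
  "hermitian A \<longleftrightarrow> dagger A = A"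

definition projector :: "nat \<Rightarrow> complex mat \<Rightarrow> bool" where
  "projector n P \<longleftrightarrow> P \<in> carrier_mat n n \<and> hermitian P \<and> P * P = P"

text \<open>Kronecker (tensor) products; the index of a bipartite basis vector |a>|b>
  is a * dB + b.\<close>
definition kron :: "complex mat \<Rightarrow> complex mat \<Rightarrow> complex mat" where
  "kron A B = mat (dim_row A * dim_row B) (dim_col A * dim_col B)
     (\<lambda>(i,j). A $$ (i div dim_row B, j div dim_col B) * B $$ (i mod dim_row B, j mod dim_col B))"

definition kron_vec :: "complex vec \<Rightarrow> complex vec \<Rightarrow> complex vec" where
  "kron_vec a b = vec (dim_vec a * dim_vec b) (\<lambda>i. a $ (i div dim_vec b) * b $ (i mod dim_vec b))"

definition sorted_eigenvalues :: "complex mat \<Rightarrow> real list" where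
  "sorted_eigenvalues A = (THE es. length es = dim_row A \<and> sorted_wrt (\<ge>) es \<and>
       char_poly A = (\<Prod>e\<leftarrow>es. [:- complex_of_real e, 1:]))"

definition second_eigenvalue :: "complex mat \<Rightarrow> real" where
  "second_eigenvalue A = sorted_eigenvalues A ! 1"

definition spectral_gap :: "complex mat \<Rightarrow> real" where
  "spectral_gap A = 1 - second_eigenvalue A"

definition msum :: "nat \<Rightarrow> complex mat list \<Rightarrow> complex mat" where
  "msum n Ms = foldr (+) Ms (0\<^sub>m n n)"

definition mtrace :: "complex mat \<Rightarrow> complex" where
  "mtrace A = (\<Sum>i<dim_row A. A $$ (i,i))"

text \<open>A quantum channel on an n-dimensional system, given by a list of Kraus operators
  (every CPTP map admits such a finite Kraus representation).\<close>
definition kraus_channel :: "nat \<Rightarrow> complex mat list \<Rightarrow> bool" where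
  "kraus_channel n Ks \<longleftrightarrow> (\<forall>K\<in>set Ks. K \<in> carrier_mat n n) \<and>
     msum n (map (\<lambda>K. dagger K * K) Ks) = 1\<^sub>m n"

definition apply_channel :: "nat \<Rightarrow> complex mat list \<Rightarrow> complex mat \<Rightarrow> complex mat" where
  "apply_channel n Ks \<rho> = msum n (map (\<lambda>K. K * \<rho> * dagger K) Ks)"

text \<open>A projective measurement on C^n: a list of orthogonal projectors summing to the identity
  (then they are automatically mutually orthogonal).\<close>
definition proj_meas :: "nat \<Rightarrow> complex mat list \<Rightarrow> bool" where
  "proj_meas n Ps \<longleftrightarrow> (\<forall>P\<in>set Ps. projector n P) \<and> msum n Ps = 1\<^sub>m n"

text \<open>A nonadaptive local projective measurement: Alice performs the projective measurement
  As, Bob the projective measurement Bs.\<close>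
type_synonym local_meas = "complex mat list \<times> complex mat list"

definition local_proj_meas :: "nat \<Rightarrow> nat \<Rightarrow> local_meas \<Rightarrow> bool" where
  "local_proj_meas dA dB M \<longleftrightarrow> proj_meas dA (fst M) \<and> proj_meas dB (snd M)"

text \<open>A test based on a local projective measurement M: the set S of accepted outcome pairs
  (a,b).  Its test projector is the sum of A_a (x) B_b over (a,b) in S.\<close>
type_synonym test = "local_meas \<times> (nat \<times> nat) set"

definition valid_test :: "nat \<Rightarrow> nat \<Rightarrow> test \<Rightarrow> bool" where
  "valid_test dA dB t \<longleftrightarrow> local_proj_meas dA dB (fst t) \<and>
     snd t \<subseteq> {..<length (fst (fst t))} \<times> {..<length (snd (fst t))}"

definition test_projector :: "nat \<Rightarrow> nat \<Rightarrow> test \<Rightarrow> complex mat" where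
  "test_projector dA dB t =
     mat (dA*dB) (dA*dB) (\<lambda>ij.
       \<Sum>ab\<in>snd t. kron (fst (fst t) ! fst ab) (snd (fst t) ! snd ab) $$ ij)"

text \<open>A verification protocol (strategy) for a pure state: tests performed with positive
  probabilities p_l summing to one.\<close>
type_synonym strategy = "(real \<times> test) list"

definition verification_operator :: "nat \<Rightarrow> nat \<Rightarrow> strategy \<Rightarrow> complex mat" where
  "verification_operator dA dB S =
     msum (dA*dB) (map (\<lambda>(p,t). complex_of_real p \<cdot>\<^sub>m test_projector dA dB t) S)"

definition state_verification_protocol :: "nat \<Rightarrow> nat \<Rightarrow> complex vec \<Rightarrow> strategy \<Rightarrow> bool" where
  "state_verification_protocol dA dB \<phi> S \<longleftrightarrow>
     S \<noteq> [] \<and> (\<forall>(p,t)\<in>set S. p > 0 \<and> valid_test dA dB t) \<and> sum_list (map fst S) = 1 \<and>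
     (\<forall>(p,t)\<in>set S. braket \<phi> (test_projector dA dB t *\<^sub>v \<phi>) = 1)"

definition ordinary_strategy :: "nat \<Rightarrow> nat \<Rightarrow> strategy \<Rightarrow> bool" where
  "ordinary_strategy dA dB S \<longleftrightarrow> spectral_gap (verification_operator dA dB S) > 0"

definition pure_product_state :: "nat \<Rightarrow> nat \<Rightarrow> complex vec \<Rightarrow> bool" where
  "pure_product_state dA dB \<psi> \<longleftrightarrow>
     (\<exists>a b. unit_vec dA a \<and> unit_vec dB b \<and> \<psi> = kron_vec a b)"

text \<open>A protocol for a unitary: a list of pairs (input test state psi_j, verification
  protocol for the output state U psi_j).\<close>
type_synonym unitary_protocol = "(complex vec \<times> strategy) list"

definition unitary_verification_protocol ::
  "nat \<Rightarrow> nat \<Rightarrow> complex mat \<Rightarrow> unitary_protocol \<Rightarrow> bool" where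
  "unitary_verification_protocol dA dB U Pr \<longleftrightarrow>
     (\<forall>(\<psi>,S)\<in>set Pr. pure_product_state dA dB \<psi> \<and>
        state_verification_protocol dA dB (U *\<^sub>v \<psi>) S)"

definition ordinary_protocol :: "nat \<Rightarrow> nat \<Rightarrow> unitary_protocol \<Rightarrow> bool" where
  "ordinary_protocol dA dB Pr \<longleftrightarrow> (\<forall>(\<psi>,S)\<in>set Pr. ordinary_strategy dA dB S)"

definition passes_with_certainty ::
  "nat \<Rightarrow> nat \<Rightarrow> complex mat list \<Rightarrow> complex vec \<Rightarrow> strategy \<Rightarrow> bool" where
  "passes_with_certainty dA dB Ks \<psi> S \<longleftrightarrow>
     (\<forall>(p,t)\<in>set S. mtrace (test_projector dA dB t * apply_channel (dA*dB) Ks (ketbra \<psi>)) = 1)"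

definition verifies_reliably :: "nat \<Rightarrow> nat \<Rightarrow> complex mat \<Rightarrow> unitary_protocol \<Rightarrow> bool" where
  "verifies_reliably dA dB U Pr \<longleftrightarrow>
     (\<forall>Ks. kraus_channel (dA*dB) Ks \<longrightarrow>
        (\<forall>(\<psi>,S)\<in>set Pr. passes_with_certainty dA dB Ks \<psi> S) \<longrightarrow>
        (\<forall>\<rho>\<in>carrier_mat (dA*dB) (dA*dB). apply_channel (dA*dB) Ks \<rho> = U * \<rho> * dagger U))"

definition num_settings :: "unitary_protocol \<Rightarrow> nat" where
  "num_settings Pr = card (\<Union>(\<psi>,S)\<in>set Pr. (\<lambda>(p,t). (\<psi>, fst t)) ` set S)"

text \<open>mu(U): minimum number of settings over ordinary protocols verifying U
  (infinity if there is none).\<close>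
definition mu :: "nat \<Rightarrow> nat \<Rightarrow> complex mat \<Rightarrow> enat" where
  "mu dA dB U = (INF Pr\<in>{Pr. unitary_verification_protocol dA dB U Pr \<and>
       ordinary_protocol dA dB Pr \<and> verifies_reliably dA dB U Pr}. enat (num_settings Pr))"

end

theory Submission
  imports Defs "HOL-Computational_Algebra.Fundamental_Theorem_Algebra"
begin

text \<open>
  Lower bound: if the input states do not span the space, choose \<open>w \<noteq> 0\<close> orthogonal to all of them;
  precomposing \<open>U\<close> with the reflection \<open>1 - 2 |w><w| / <w|w>\<close> gives a different channel passing every test.

  Upper bound, states: write \<open>\<phi> = \<Sum>k. w\<^sub>k \<otimes> c\<^sub>k\<close> with \<open>c\<close> an orthonormal eigenbasis of Bob's reduced state, so
  that the \<open>w\<^sub>k\<close> are mutually orthogonal. The first test accepts the correlated outcomes \<open>(w\<^sub>k, c\<^sub>k)\<close>, and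
  the vectors passing it are \<open>\<Sum>k. \<beta>\<^sub>k w\<^sub>k \<otimes> c\<^sub>k\<close>. In the second test Alice projects onto \<open>u = \<Sum>k. w\<^sub>k\<close>;
  in case of success Bob must find the conditional state \<open>v\<close> of \<open>\<phi>\<close>, which forces all \<open>\<beta>\<^sub>k\<close> with
  \<open>w\<^sub>k \<noteq> 0\<close> to agree. So two settings verify any bipartite pure state.

  Upper bound, unitaries: the products of the vectors \<open>e\<^sub>0\<close> and \<open>(e\<^sub>0 + e\<^sub>j) / sqrt 2\<close> are \<open>d\<close> linearly independent
  states, none orthogonal to \<open>e\<^sub>0 \<otimes> e\<^sub>0\<close>. If every Kraus operator \<open>K\<close> maps each \<open>\<psi>\<^sub>j\<close> to \<open>\<gamma>\<^sub>K\<^sub>j U \<psi>\<^sub>j\<close>, trace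
  preservation makes \<open>\<gamma>\<^sub>K\<^sub>j\<close> independent of \<open>j\<close>, so \<open>K\<close> is a multiple of \<open>U\<close>.
\<close>

subsection \<open>Orthonormal families and the spectral theorem\<close>

lemma dagger_carrier [simp]: "A \<in> carrier_mat m n \<Longrightarrow> dagger A \<in> carrier_mat n m"
  by (simp add: dagger_def)

lemma dagger_index [simp]: "i < dim_col A \<Longrightarrow> j < dim_row A \<Longrightarrow> dagger A $$ (i, j) = cnj (A $$ (j, i))"
  by (simp add: dagger_def)

lemma dagger_dim [simp]: "dim_row (dagger A) = dim_col A" "dim_col (dagger A) = dim_row A"
  by (simp_all add: dagger_def)

lemma dagger_dagger [simp]: "dagger (dagger A) = A"
  by (rule eq_matI) auto

lemma dagger_mult:
  assumes "A \<in> carrier_mat m n" "B \<in> carrier_mat n k"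
  shows "dagger (A * B) = dagger B * dagger A"
  using assms by (intro eq_matI) (auto simp: scalar_prod_def mult.commute)

lemma mult_mat_vec_index:
  "A \<in> carrier_mat m n \<Longrightarrow> v \<in> carrier_vec n \<Longrightarrow> i < m \<Longrightarrow> (A *\<^sub>v v) $ i = (\<Sum>j<n. A $$ (i, j) * v $ j)"
  by (auto simp: scalar_prod_def lessThan_atLeast0)

lemma mult_mat_index:
  "A \<in> carrier_mat m n \<Longrightarrow> B \<in> carrier_mat n k \<Longrightarrow> i < m \<Longrightarrow> j < k \<Longrightarrow>
   (A * B) $$ (i, j) = (\<Sum>l<n. A $$ (i, l) * B $$ (l, j))"
  by (auto simp: scalar_prod_def lessThan_atLeast0)

lemma braket_eq: "v \<in> carrier_vec n \<Longrightarrow> braket u v = (\<Sum>i<n. cnj (u $ i) * v $ i)"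
  by (auto simp: braket_def)

lemma cnj_braket: "u \<in> carrier_vec n \<Longrightarrow> v \<in> carrier_vec n \<Longrightarrow> cnj (braket u v) = braket v u"
  by (simp add: braket_eq mult.commute)

lemma braket_add_right:
  "v \<in> carrier_vec n \<Longrightarrow> w \<in> carrier_vec n \<Longrightarrow> braket u (v + w) = braket u v + braket u w"
  by (simp add: braket_eq[of _ n] distrib_left sum.distrib)

lemma braket_minus_right:
  "v \<in> carrier_vec n \<Longrightarrow> w \<in> carrier_vec n \<Longrightarrow> braket u (v - w) = braket u v - braket u w"
  by (simp add: braket_eq[of _ n] right_diff_distrib sum_subtractf)

lemma braket_smult_right: "braket u (c \<cdot>\<^sub>v v) = c * braket u v"
  by (simp add: braket_def sum_distrib_left mult.left_commute)

lemma braket_smult_left: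
  "u \<in> carrier_vec n \<Longrightarrow> v \<in> carrier_vec n \<Longrightarrow> braket (c \<cdot>\<^sub>v u) v = cnj c * braket u v"
  by (simp add: braket_eq[of _ n] sum_distrib_left mult.assoc)

lemma braket_minus_left:
  "u \<in> carrier_vec n \<Longrightarrow> v \<in> carrier_vec n \<Longrightarrow> w \<in> carrier_vec n \<Longrightarrow>
   braket (u - v) w = braket u w - braket v w"
  by (simp add: braket_eq[of _ n] left_diff_distrib sum_subtractf)

lemma braket_zero_right [simp]: "braket u (0\<^sub>v n) = 0"
  by (simp add: braket_def)

lemma braket_self_real: "braket v v = complex_of_real (\<Sum>i<dim_vec v. (cmod (v $ i))\<^sup>2)"
  unfolding braket_def of_real_sum by (intro sum.cong refl) (metis complex_norm_square mult.commute of_real_power)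

lemma braket_self_eq_0_iff: "v \<in> carrier_vec n \<Longrightarrow> braket v v = 0 \<longleftrightarrow> v = 0\<^sub>v n"
  unfolding braket_self_real of_real_eq_0_iff
  by (subst sum_nonneg_eq_0_iff) auto

lemma Re_braket_self_nonneg: "Re (braket v v) \<ge> 0"
  by (simp add: braket_self_real sum_nonneg)

lemma of_real_Re_braket_self: "complex_of_real (Re (braket v v)) = braket v v"
  by (simp add: braket_self_real)

lemma braket_mult_mat_right:
  assumes "A \<in> carrier_mat m n" "u \<in> carrier_vec m" "v \<in> carrier_vec n"
  shows "braket u (A *\<^sub>v v) = braket (dagger A *\<^sub>v u) v"
proof -
  have "braket u (A *\<^sub>v v) = (\<Sum>i<m. \<Sum>j<n. cnj (u $ i) * A $$ (i, j) * v $ j)"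
    using assms by (simp add: braket_eq[of _ m] mult_mat_vec_index[of A m n] sum_distrib_left mult.assoc del: index_mult_mat_vec)
  also have "\<dots> = (\<Sum>j<n. \<Sum>i<m. cnj (u $ i) * A $$ (i, j) * v $ j)"
    by (rule sum.swap)
  also have "\<dots> = braket (dagger A *\<^sub>v u) v"
    using assms by (simp add: braket_eq[of _ n] mult_mat_vec_index[of "dagger A" n m] sum_distrib_right 
        sum_distrib_left mult_ac del: index_mult_mat_vec)
  finally show ?thesis .
qed

lemma braket_mult_mat_cols:
  assumes "A \<in> carrier_mat n m" "y \<in> carrier_vec m"
  shows "braket u (A *\<^sub>v y) = (\<Sum>j<m. y $ j * braket u (col A j))"
proof -
  have "braket u (A *\<^sub>v y) = (\<Sum>i<n. \<Sum>j<m. y $ j * (cnj (u $ i) * A $$ (i, j)))"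
    using assms by (simp add: braket_eq[of _ n] mult_mat_vec_index[of A n m] sum_distrib_left mult_ac del: index_mult_mat_vec)
  also have "\<dots> = (\<Sum>j<m. y $ j * braket u (col A j))"
    using assms by (subst sum.swap) (simp add: braket_eq[of _ n] sum_distrib_left)
  finally show ?thesis .
qed

lemma eq_of_minus_vec_eq_0:
  assumes "u \<in> carrier_vec n" "v \<in> carrier_vec n" and eq: "u - v = (0\<^sub>v n :: complex vec)"
  shows "u = v"
proof (rule eq_vecI)
  fix i assume "i < dim_vec v"
  then have "i < n" using assms by simp
  then have "(u - v) $ i = 0" unfolding eq by simp
  then show "u $ i = v $ i" using assms(1,2) \<open>i < n\<close> by simp
qed (use assms in auto)

definition orthonormal :: "nat \<Rightarrow> nat \<Rightarrow> (nat \<Rightarrow> complex vec) \<Rightarrow> bool" where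
  "orthonormal n k v \<longleftrightarrow> (\<forall>i<k. v i \<in> carrier_vec n) \<and>
     (\<forall>i<k. \<forall>j<k. braket (v i) (v j) = (if i = j then 1 else 0))"

lemma exists_orthogonal_vec:
  assumes "k < n" "\<And>i. i < k \<Longrightarrow> v i \<in> carrier_vec n"
  shows "\<exists>w\<in>carrier_vec n. w \<noteq> 0\<^sub>v n \<and> (\<forall>i<k. braket (v i) w = 0)"
proof -
  define A where "A = mat\<^sub>r n n (\<lambda>i. if i = k then 0\<^sub>v n else vec n (\<lambda>j. if i < k then cnj (v i $ j) else 0))"
  have A: "A \<in> carrier_mat n n" by (simp add: A_def)
  have "det A = 0" unfolding A_def using assms(1) by (intro det_row_0) auto
  then obtain w where w: "w \<in> carrier_vec n" "w \<noteq> 0\<^sub>v n" "A *\<^sub>v w = 0\<^sub>v n"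
    using det_0_iff_vec_prod_zero[OF A] by blast
  have "braket (v i) w = 0" if "i < k" for i
  proof -
    have "braket (v i) w = (A *\<^sub>v w) $ i"
      unfolding mult_mat_vec_index[OF A w(1) less_trans[OF that assms(1)]]
      using w(1) that assms(1) by (simp add: braket_eq[of _ n] A_def)
    then show ?thesis using w(3) that assms(1) by simp
  qed
  then show ?thesis using w by blast
qed

lemma normalize_vec:
  assumes "w \<in> carrier_vec n" "w \<noteq> 0\<^sub>v n"
  obtains c where "c \<noteq> 0" "braket (c \<cdot>\<^sub>v w) (c \<cdot>\<^sub>v w) = 1"
proof -
  define r where "r = Re (braket w w)"
  have "r \<noteq> 0"
    using assms of_real_Re_braket_self[of w] braket_self_eq_0_iff[of w n] by (auto simp: r_def)
  then have r: "r > 0" using Re_braket_self_nonneg[of w] by (simp add: r_def)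
  have rr: "braket w w = complex_of_real r" by (simp add: r_def of_real_Re_braket_self)
  define c where "c = complex_of_real (1 / sqrt r)"
  have "braket (c \<cdot>\<^sub>v w) (c \<cdot>\<^sub>v w) = cnj c * c * braket w w"
    using assms by (simp add: braket_smult_left[of _ n] braket_smult_right)
  also have "\<dots> = complex_of_real ((1 / sqrt r) * (1 / sqrt r) * r)"
    by (simp only: rr c_def complex_cnj_complex_of_real of_real_mult)
  also have "(1 / sqrt r) * (1 / sqrt r) * r = 1" using r by simp
  finally have "braket (c \<cdot>\<^sub>v w) (c \<cdot>\<^sub>v w) = 1" by simp
  moreover have "c \<noteq> 0" using r by (simp add: c_def)
  ultimately show ?thesis using that by blast
qed

lemma orthonormal_snoc:
  assumes "orthonormal n k v" "w \<in> carrier_vec n" "braket w w = 1"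
    "\<And>i. i < k \<Longrightarrow> braket (v i) w = 0"
  shows "orthonormal n (Suc k) (v(k := w))"
proof -
  have "braket w (v i) = 0" if "i < k" for i
    using assms that cnj_braket[of "v i" n w] by (auto simp: orthonormal_def)
  then show ?thesis using assms by (auto simp: orthonormal_def less_Suc_eq)
qed

lemma orthonormal_extend:
  assumes "orthonormal n k v" "k \<le> m" "m \<le> n"
  shows "\<exists>v'. orthonormal n m v' \<and> (\<forall>i<k. v' i = v i)"
  using assms(2,3)
proof (induction m rule: dec_induct)
  case base
  then show ?case using assms(1) by blast
next
  case (step m)
  then obtain v' where v': "orthonormal n m v'" "\<forall>i<k. v' i = v i" by auto
  obtain w where w: "w \<in> carrier_vec n" "w \<noteq> 0\<^sub>v n" "\<forall>i<m. braket (v' i) w = 0"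
    using exists_orthogonal_vec[of m n v'] step v'(1) by (auto simp: orthonormal_def)
  obtain c where c: "braket (c \<cdot>\<^sub>v w) (c \<cdot>\<^sub>v w) = 1" using normalize_vec[OF w(1,2)] by blast
  have "orthonormal n (Suc m) (v'(m := c \<cdot>\<^sub>v w))"
    using w c by (intro orthonormal_snoc v'(1)) (auto simp: braket_smult_right)
  moreover have "\<forall>i<k. (v'(m := c \<cdot>\<^sub>v w)) i = v i" using v'(2) step.hyps by auto
  ultimately show ?case by blast
qed

lemma orthonormal_basis_unitary:
  assumes "orthonormal n n v"
  defines "W \<equiv> mat n n (\<lambda>(i, j). v j $ i)"
  shows "unitary n W"
proof -
  have W: "W \<in> carrier_mat n n" by (simp add: W_def)
  have "dagger W * W = 1\<^sub>m n"
  proof (rule eq_matI)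
    fix i j assume "i < dim_row (1\<^sub>m n)" "j < dim_col (1\<^sub>m n)"
    then have ij: "i < n" "j < n" by auto
    have "(dagger W * W) $$ (i, j) = (\<Sum>l<n. cnj (v i $ l) * v j $ l)"
      using ij W by (subst mult_mat_index[of _ n n]) (auto simp: W_def)
    also have "\<dots> = braket (v i) (v j)" using assms(1) ij by (subst braket_eq) (auto simp: orthonormal_def)
    finally show "(dagger W * W) $$ (i, j) = 1\<^sub>m n $$ (i, j)"
      using assms(1) ij by (auto simp: orthonormal_def)
  qed (use W in auto)
  then show ?thesis
    using mat_mult_left_right_inverse[of "dagger W" n W] W by (auto simp: unitary_def)
qed

lemma orthonormal_basis_completeness:
  assumes "orthonormal n n v" "i < n" "j < n"
  shows "(\<Sum>k<n. v k $ i * cnj (v k $ j)) = (if i = j then 1 else 0)"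
proof -
  define W where "W = mat n n (\<lambda>(i, j). v j $ i)"
  have W: "W \<in> carrier_mat n n" "W * dagger W = 1\<^sub>m n"
    using orthonormal_basis_unitary[OF assms(1)] by (auto simp: unitary_def W_def)
  then have "(W * dagger W) $$ (i, j) = (\<Sum>k<n. v k $ i * cnj (v k $ j))"
    using assms by (subst mult_mat_index[of _ n n]) (auto simp: W_def)
  then show ?thesis using W assms by simp
qed

lemma orthonormal_basis_eq_0:
  assumes "orthonormal n n v" "x \<in> carrier_vec n" "\<And>k. k < n \<Longrightarrow> braket (v k) x = 0"
  shows "x = 0\<^sub>v n"
proof -
  have "x $ i = 0" if "i < n" for i
  proof -
    have "x $ i = (\<Sum>j<n. (if i = j then 1 else 0) * x $ j)"
      using that by (subst sum.mono_neutral_right[of _ "{i}"]) auto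
    also have "\<dots> = (\<Sum>j<n. (\<Sum>k<n. v k $ i * cnj (v k $ j)) * x $ j)"
      using orthonormal_basis_completeness[OF assms(1) that] by (intro sum.cong) auto
    also have "\<dots> = (\<Sum>k<n. v k $ i * braket (v k) x)"
      using assms(2) unfolding braket_eq[OF assms(2)]
      by (simp add: sum_distrib_left sum_distrib_right mult.assoc) (rule sum.swap)
    finally show ?thesis using assms(3) by simp
  qed
  then show ?thesis using assms(2) by (intro eq_vecI) auto
qed

lemma complex_mat_has_eigenvector:
  assumes "A \<in> carrier_mat n n" "n > 0"
  shows "\<exists>x\<in>carrier_vec n. \<exists>k :: complex. x \<noteq> 0\<^sub>v n \<and> A *\<^sub>v x = k \<cdot>\<^sub>v x"
proof -
  have "degree (char_poly A) > 0" using degree_monic_char_poly[OF assms(1)] assms(2) by simp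
  then obtain k where "poly (char_poly A) k = 0"
    using alg_closed_imp_poly_has_root by blast
  then have "eigenvalue A k" using eigenvalue_root_char_poly[OF assms(1)] by simp
  then show ?thesis using assms(1) by (auto simp: eigenvalue_def eigenvector_def)
qed

lemma hermitian_eigenvalue_real:
  assumes "A \<in> carrier_mat n n" "hermitian A" "x \<in> carrier_vec n" "x \<noteq> 0\<^sub>v n" "A *\<^sub>v x = k \<cdot>\<^sub>v x"
  shows "k = complex_of_real (Re k)"
proof -
  have "k * braket x x = braket x (A *\<^sub>v x)" by (simp add: assms(5) braket_smult_right)
  also have "\<dots> = braket (A *\<^sub>v x) x"
    using assms(2) braket_mult_mat_right[OF assms(1,3,3)] by (simp add: hermitian_def)
  also have "\<dots> = cnj k * braket x x" using assms(3,5) by (simp add: braket_smult_left)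
  finally have "cnj k = k" using braket_self_eq_0_iff[OF assms(3)] assms(4) by simp
  then show ?thesis by (simp add: complex_eq_iff)
qed

lemma hermitian_spectral:
  assumes A: "A \<in> carrier_mat n n" "hermitian A"
  shows "\<exists>v d. orthonormal n n v \<and> (\<forall>i<n. A *\<^sub>v v i = complex_of_real (d i) \<cdot>\<^sub>v v i)"
proof -
  have "\<exists>v d. orthonormal n k v \<and> (\<forall>i<k. A *\<^sub>v v i = complex_of_real (d i) \<cdot>\<^sub>v v i)" if "k \<le> n" for k
    using that
  proof (induction k)
    case 0
    then show ?case by (auto simp: orthonormal_def)
  next
    case (Suc k)
    then obtain v d where v: "orthonormal n k v" "\<forall>i<k. A *\<^sub>v v i = complex_of_real (d i) \<cdot>\<^sub>v v i"
      by auto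
    obtain u where u: "orthonormal n n u" "\<forall>i<k. u i = v i"
      using orthonormal_extend[OF v(1), of n] Suc by auto
    have uc: "\<And>i. i < n \<Longrightarrow> u i \<in> carrier_vec n"
      and uu: "\<And>i j. i < n \<Longrightarrow> j < n \<Longrightarrow> braket (u i) (u j) = (if i = j then 1 else 0)"
      using u(1) by (auto simp: orthonormal_def)
    define m where "m = n - k"
    have m: "m > 0" "k + m = n" using Suc by (auto simp: m_def)
    define V where "V = mat n m (\<lambda>(i, j). u (k + j) $ i)"
    have V: "V \<in> carrier_mat n m" by (simp add: V_def)
    have colV: "col V j = u (k + j)" if "j < m" for j
      using that m uc[of "k + j"] by (intro eq_vecI) (auto simp: V_def)
    define B where "B = mat m m (\<lambda>(i, j). braket (u (k + i)) (A *\<^sub>v u (k + j)))"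
    have B: "B \<in> carrier_mat m m" by (simp add: B_def)
    obtain y c where y: "y \<in> carrier_vec m" "y \<noteq> 0\<^sub>v m" "B *\<^sub>v y = c \<cdot>\<^sub>v y"
      using complex_mat_has_eigenvector[OF B m(1)] by blast
    define x where "x = V *\<^sub>v y"
    have x: "x \<in> carrier_vec n" using V y by (simp add: x_def)
    have Ax: "A *\<^sub>v x = (A * V) *\<^sub>v y" using A V y by (simp add: x_def)
    have ux0: "braket (u i) x = 0" if "i < k" for i
      using that m by (simp add: x_def braket_mult_mat_cols[OF V y(1)] colV uu)
    have ux: "braket (u (k + i)) x = y $ i" if "i < m" for i
      using that m by (simp add: x_def braket_mult_mat_cols[OF V y(1)] colV uu sum.delta if_distrib cong: if_cong)
    have uA0: "braket (u i) (A *\<^sub>v x) = 0" if "i < k" for i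
    proof -
      have "braket (u i) (A *\<^sub>v x) = braket (A *\<^sub>v u i) x"
        using A uc[of i] x that m by (subst braket_mult_mat_right[of _ n n]) (auto simp: hermitian_def)
      also have "A *\<^sub>v u i = complex_of_real (d i) \<cdot>\<^sub>v u i" using v(2) u(2) that by simp
      finally show ?thesis using ux0[OF that] uc[of i] x that m by (simp add: braket_smult_left[of _ n])
    qed
    have uA: "braket (u (k + i)) (A *\<^sub>v x) = c * y $ i" if "i < m" for i
    proof -
      have colAV: "col (A * V) j = A *\<^sub>v u (k + j)" if "j < m" for j
        using col_mult2[OF A(1) V that] unfolding colV[OF that] .
      have "braket (u (k + i)) (A *\<^sub>v x) = (\<Sum>j<m. y $ j * braket (u (k + i)) (col (A * V) j))"
        unfolding Ax by (rule braket_mult_mat_cols) (use A V y in auto)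
      also have "\<dots> = (\<Sum>j<m. y $ j * braket (u (k + i)) (A *\<^sub>v u (k + j)))"
        by (intro sum.cong refl) (simp only: colAV lessThan_iff)
      also have "\<dots> = (B *\<^sub>v y) $ i"
        unfolding mult_mat_vec_index[OF B y(1) that] using that by (simp add: B_def mult.commute)
      finally show ?thesis using that y by simp
    qed
    have "A *\<^sub>v x - c \<cdot>\<^sub>v x = 0\<^sub>v n"
    proof (rule orthonormal_basis_eq_0[OF u(1)])
      fix i assume i: "i < n"
      have "braket (u i) (A *\<^sub>v x) = c * braket (u i) x"
      proof (cases "i < k")
        case False
        then obtain j where "i = k + j" "j < m" using i m by (metis add_less_cancel_left le_Suc_ex not_less)
        then show ?thesis using uA ux by simp
      qed (simp add: uA0 ux0)
      then show "braket (u i) (A *\<^sub>v x - c \<cdot>\<^sub>v x) = 0"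
        using A x by (simp add: braket_minus_right[of _ n] braket_smult_right)
    qed (use A x in auto)
    then have eig: "A *\<^sub>v x = c \<cdot>\<^sub>v x"
      using A x eq_of_minus_vec_eq_0[of "A *\<^sub>v x" n "c \<cdot>\<^sub>v x"] by simp
    have x0: "x \<noteq> 0\<^sub>v n"
    proof
      assume "x = 0\<^sub>v n"
      then have "y $ i = 0" if "i < m" for i using ux[OF that] by simp
      then show False using y by (auto intro!: eq_vecI)
    qed
    have creal: "c = complex_of_real (Re c)" using hermitian_eigenvalue_real[OF A x x0 eig] .
    obtain a where a: "braket (a \<cdot>\<^sub>v x) (a \<cdot>\<^sub>v x) = 1" using normalize_vec[OF x x0] by blast
    have "orthonormal n (Suc k) (v(k := a \<cdot>\<^sub>v x))"
      using v(1) x a ux0 u(2) by (intro orthonormal_snoc) (auto simp: braket_smult_right)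
    moreover have "A *\<^sub>v (a \<cdot>\<^sub>v x) = complex_of_real (Re c) \<cdot>\<^sub>v (a \<cdot>\<^sub>v x)"
      by (subst creal[symmetric]) (use eig x A in \<open>simp add: mult_mat_vec[of _ n n] smult_smult_assoc mult.commute\<close>)
    ultimately have "orthonormal n (Suc k) (v(k := a \<cdot>\<^sub>v x)) \<and> (\<forall>i<Suc k. 
        A *\<^sub>v (v(k := a \<cdot>\<^sub>v x)) i = complex_of_real ((d(k := Re c)) i) \<cdot>\<^sub>v (v(k := a \<cdot>\<^sub>v x)) i)"
      using v(2) by (simp add: less_Suc_eq)
    then show ?case by blast
  qed
  then show ?thesis by blast
qed

subsection \<open>The second largest eigenvalue\<close>

lemma prod_linear_factors_eq_imp_mset_eq:
  fixes es es' :: "real list"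
  assumes "(\<Prod>e\<leftarrow>es. [:- complex_of_real e, 1:]) = (\<Prod>e\<leftarrow>es'. [:- complex_of_real e, 1:])"
  shows "mset es = mset es'"
proof -
  have proots: "image_mset Re (proots (\<Prod>e\<leftarrow>es. [:- complex_of_real e, 1:])) = mset es" for es
  proof -
    have "proots (\<Prod>e\<leftarrow>es. [:- complex_of_real e, 1:]) = 
        sum_list (map proots (map (\<lambda>e. [:- complex_of_real e, 1:]) es))"
      by (subst proots_prod_list[symmetric]) auto
    also have "\<dots> = image_mset complex_of_real (mset es)" by (induction es) auto
    finally show ?thesis by (simp add: multiset.map_comp comp_def)
  qed
  show ?thesis using proots[of es] proots[of es'] assms by simp
qed

lemma sorted_eigenvaluesI:
  assumes "A \<in> carrier_mat n n" "char_poly A = (\<Prod>e\<leftarrow>ds. [:- complex_of_real e, 1:])"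
    and "length ds = n"
  shows "sorted_eigenvalues A = rev (sort ds)"
  unfolding sorted_eigenvalues_def
proof (rule the_equality)
  show "length (rev (sort ds)) = dim_row A \<and> sorted_wrt (\<ge>) (rev (sort ds)) \<and>
      char_poly A = (\<Prod>e\<leftarrow>rev (sort ds). [:- complex_of_real e, 1:])"
  proof (intro conjI)
    show "length (rev (sort ds)) = dim_row A" using assms(1,3) by simp
    show "sorted_wrt (\<ge>) (rev (sort ds))" unfolding sorted_wrt_rev by simp
    show "char_poly A = (\<Prod>e\<leftarrow>rev (sort ds). [:- complex_of_real e, 1:])"
      unfolding assms(2) prod_mset_prod_list[symmetric] mset_map mset_rev mset_sort ..
  qed
next
  fix es assume es: "length es = dim_row A \<and> sorted_wrt (\<ge>) es \<and>
      char_poly A = (\<Prod>e\<leftarrow>es. [:- complex_of_real e, 1:])"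
  then have "mset es = mset ds" using assms(2) by (intro prod_linear_factors_eq_imp_mset_eq) metis
  then have "mset (rev es) = mset ds" by simp
  moreover have "sorted (rev es)" using es by (simp add: sorted_wrt_rev)
  ultimately have "sort ds = rev es" by (metis properties_for_sort)
  then show "es = rev (sort ds)" by simp
qed

lemma char_poly_orthonormal_eigenbasis:
  assumes A: "A \<in> carrier_mat n n" and v: "orthonormal n n v"
    and eig: "\<And>i. i < n \<Longrightarrow> A *\<^sub>v v i = complex_of_real (d i) \<cdot>\<^sub>v v i"
  shows "char_poly A = (\<Prod>e\<leftarrow>map d [0..<n]. [:- complex_of_real e, 1:])"
proof -
  define W where "W = mat n n (\<lambda>(i, j). v j $ i)"
  define D where "D = mat n n (\<lambda>(i, j). if i = j then complex_of_real (d i) else 0)"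
  have D: "D \<in> carrier_mat n n" by (simp add: D_def)
  have W: "W \<in> carrier_mat n n" "W * dagger W = 1\<^sub>m n" "dagger W * W = 1\<^sub>m n"
    using orthonormal_basis_unitary[OF v] by (auto simp: unitary_def W_def)
  have vc: "v i \<in> carrier_vec n" if "i < n" for i using v that by (auto simp: orthonormal_def)
  have "A * W = W * D"
  proof (rule eq_matI)
    fix i j assume "i < dim_row (W * D)" "j < dim_col (W * D)"
    then have ij: "i < n" "j < n" using W D by auto
    have "(A * W) $$ (i, j) = (A *\<^sub>v v j) $ i"
      unfolding mult_mat_index[OF A W(1) ij] mult_mat_vec_index[OF A vc[OF ij(2)] ij(1)]
      using ij by (simp add: W_def)
    also have "\<dots> = W $$ (i, j) * D $$ (j, j)" using ij vc[of j] by (simp add: eig W_def D_def)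
    also have "\<dots> = (\<Sum>l<n. W $$ (i, l) * D $$ (l, j))"
      using ij by (subst sum.mono_neutral_right[of _ "{j}"]) (auto simp: D_def)
    also have "\<dots> = (W * D) $$ (i, j)" by (rule mult_mat_index[OF W(1) D ij, symmetric])
    finally show "(A * W) $$ (i, j) = (W * D) $$ (i, j)" .
  qed (use A W D in auto)
  then have "A = W * D * dagger W"
    using assoc_mult_mat[OF A W(1) dagger_carrier[OF W(1)]] W(2) A by simp
  then have "similar_mat_wit A D W (dagger W)"
    using A W D by (intro similar_mat_witI[of _ _ n]) auto
  then have "char_poly A = char_poly D" by (intro char_poly_similar) (auto simp: similar_mat_def)
  also have "\<dots> = (\<Prod>a\<leftarrow>diag_mat D. [:- a, 1:])"
    by (intro char_poly_upper_triangular[OF D]) (auto simp: D_def upper_triangular_def)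
  also have "diag_mat D = map (\<lambda>i. complex_of_real (d i)) [0..<n]" by (simp add: diag_mat_def D_def)
  finally show ?thesis by (simp add: comp_def)
qed

lemma second_eigenvalue_less:
  assumes A: "A \<in> carrier_mat n n" "hermitian A" and n: "n \<ge> 2"
    and no_pair: "\<And>x y a b. x \<in> carrier_vec n \<Longrightarrow> y \<in> carrier_vec n \<Longrightarrow> braket x x = 1 \<Longrightarrow> braket y y = 1 \<Longrightarrow>
      braket x y = 0 \<Longrightarrow> A *\<^sub>v x = complex_of_real a \<cdot>\<^sub>v x \<Longrightarrow> A *\<^sub>v y = complex_of_real b \<cdot>\<^sub>v y \<Longrightarrow>
      a \<ge> r \<Longrightarrow> b \<ge> r \<Longrightarrow> False"
  shows "second_eigenvalue A < r"
proof (rule ccontr)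
  obtain v d where v: "orthonormal n n v" "\<forall>i<n. A *\<^sub>v v i = complex_of_real (d i) \<cdot>\<^sub>v v i"
    using hermitian_spectral[OF A] by blast
  define es where "es = rev (sort (map d [0..<n]))"
  have es: "sorted_eigenvalues A = es"
    unfolding es_def by (rule sorted_eigenvaluesI[OF A(1) char_poly_orthonormal_eigenbasis[OF A(1) v(1)]]) (use v in auto)
  have len: "length es = n" by (simp add: es_def)
  have srt: "sorted_wrt (\<ge>) es" by (simp add: es_def sorted_wrt_rev)
  assume "\<not> second_eigenvalue A < r"
  then have e1: "es ! 1 \<ge> r" by (simp add: second_eigenvalue_def es)
  have e0: "es ! 0 \<ge> r" using sorted_wrt_nth_less[OF srt, of 0 1] len n e1 by simp
  have "{0, 1} \<subseteq> {i. i < length es \<and> es ! i \<ge> r}" using e0 e1 len n by auto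
  then have "card {0, 1 :: nat} \<le> card {i. i < length es \<and> es ! i \<ge> r}" by (intro card_mono) auto
  also have "\<dots> = length (filter (\<lambda>e. e \<ge> r) es)" by (simp add: length_filter_conv_card)
  also have "\<dots> = length (filter (\<lambda>e. e \<ge> r) (map d [0..<n]))"
    by (rule mset_eq_length) (simp add: es_def)
  also have "\<dots> = card {i. i < n \<and> d i \<ge> r}"
    by (simp add: length_filter_conv_card cong: conj_cong)
  finally have "card {i. i < n \<and> d i \<ge> r} \<ge> 2" by simp
  then obtain i j where "i < n" "d i \<ge> r" "j < n" "d j \<ge> r" "i \<noteq> j"
    using card_le_Suc0_iff_eq[of "{i. i < n \<and> d i \<ge> r}"] by fastforce
  then show False using no_pair[of "v i" "v j" "d i" "d j"] v by (auto simp: orthonormal_def)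
qed

subsection \<open>Tensor products and projectors\<close>

lemma prod_index:
  fixes a b m n :: nat
  assumes "a < m" "b < n"
  shows "a * n + b < m * n" "(a * n + b) div n = a" "(a * n + b) mod n = b"
proof -
  have "a * n + b < (a + 1) * n" using assms by simp
  also have "\<dots> \<le> m * n" using assms by (intro mult_right_mono) auto
  finally show "a * n + b < m * n" .
qed (use assms in auto)

lemma prod_index_decomp:
  fixes i m n :: nat
  assumes "i < m * n"
  shows "i div n < m" "i mod n < n" "i = (i div n) * n + i mod n"
proof -
  have "n > 0" using assms by (cases n) auto
  then show "i div n < m" "i mod n < n" "i = (i div n) * n + i mod n"
    using assms by (auto simp: less_mult_imp_div_less)
qed

lemma sum_prod_index: "(\<Sum>i<m * n. f i) = (\<Sum>a<m. \<Sum>b<n. f (a * n + b :: nat))"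
proof -
  have "(\<Sum>i<m * n. f i) = (\<Sum>a<m. \<Sum>i\<in>{a * n..<a * n + n}. f i)"
    by (rule sum.nat_group[symmetric])
  also have "\<dots> = (\<Sum>a<m. \<Sum>b<n. f (a * n + b))"
  proof (rule sum.cong[OF refl])
    show "(\<Sum>i\<in>{a * n..<a * n + n}. f i) = (\<Sum>b<n. f (a * n + b))" for a
      using sum.shift_bounds_nat_ivl[of f 0 "a * n" n] by (simp add: lessThan_atLeast0 add.commute)
  qed
  finally show ?thesis .
qed

lemma sum_delta_mult:
  fixes f :: "nat \<Rightarrow> 'a :: semiring_1"
  shows "i < n \<Longrightarrow> (\<Sum>j<n. (if i = j then 1 else 0) * f j) = f i"
  by (subst sum.mono_neutral_right[of _ "{i}"]) auto

lemma kron_carrier [simp]: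
  "A \<in> carrier_mat m m' \<Longrightarrow> B \<in> carrier_mat n n' \<Longrightarrow> kron A B \<in> carrier_mat (m * n) (m' * n')"
  by (simp add: kron_def)

lemma kron_index:
  assumes "A \<in> carrier_mat m m'" "B \<in> carrier_mat n n'" "i < m * n" "j < m' * n'"
  shows "kron A B $$ (i, j) = A $$ (i div n, j div n') * B $$ (i mod n, j mod n')"
  using assms by (simp add: kron_def)

lemma kron_one: "kron (1\<^sub>m m) (1\<^sub>m n) = 1\<^sub>m (m * n)"
proof (rule eq_matI)
  fix i j assume "i < dim_row (1\<^sub>m (m * n))" "j < dim_col (1\<^sub>m (m * n))"
  then have ij: "i < m * n" "j < m * n" by auto
  have "i = j" if "i div n = j div n" "i mod n = j mod n" using that by (metis div_mult_mod_eq)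
  then show "kron (1\<^sub>m m) (1\<^sub>m n) $$ (i, j) = 1\<^sub>m (m * n) $$ (i, j)"
    using ij prod_index_decomp[OF ij(1)] prod_index_decomp[OF ij(2)]
    by (subst kron_index[of _ m m _ n n]) auto
qed (auto simp: kron_def)

lemma kron_mult:
  assumes A: "A \<in> carrier_mat m p" and B: "B \<in> carrier_mat n q"
    and C: "C \<in> carrier_mat p m'" and D: "D \<in> carrier_mat q n'"
  shows "kron A B * kron C D = kron (A * C) (B * D)"
proof (rule eq_matI)
  fix i j assume "i < dim_row (kron (A * C) (B * D))" "j < dim_col (kron (A * C) (B * D))"
  then have ij: "i < m * n" "j < m' * n'" using assms by (auto simp: kron_def)
  note ij' = prod_index_decomp[OF ij(1)] prod_index_decomp[OF ij(2)]
  have "(kron A B * kron C D) $$ (i, j) = (\<Sum>l<p * q. kron A B $$ (i, l) * kron C D $$ (l, j))"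
    by (rule mult_mat_index[of _ "m * n" _ _ "m' * n'"]) (use assms ij in auto)
  also have "\<dots> = (\<Sum>k<p. \<Sum>l<q. kron A B $$ (i, k * q + l) * kron C D $$ (k * q + l, j))"
    by (rule sum_prod_index)
  also have "\<dots> = (\<Sum>k<p. \<Sum>l<q. (A $$ (i div n, k) * C $$ (k, j div n')) * (B $$ (i mod n, l) * D $$ (l, j mod n')))"
    using ij by (intro sum.cong refl) 
      (simp add: kron_index[OF A B] kron_index[OF C D] prod_index)
  also have "\<dots> = (A * C) $$ (i div n, j div n') * (B * D) $$ (i mod n, j mod n')"
    unfolding mult_mat_index[OF A C ij'(1,4)] mult_mat_index[OF B D ij'(2,5)] sum_product ..
  also have "\<dots> = kron (A * C) (B * D) $$ (i, j)"
    by (rule kron_index[symmetric]) (use assms ij in auto)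
  finally show "(kron A B * kron C D) $$ (i, j) = kron (A * C) (B * D) $$ (i, j)" .
qed (use assms in \<open>auto simp: kron_def\<close>)

lemma dagger_kron:
  assumes "A \<in> carrier_mat m m'" "B \<in> carrier_mat n n'"
  shows "dagger (kron A B) = kron (dagger A) (dagger B)"
proof (rule eq_matI)
  fix i j assume "i < dim_row (kron (dagger A) (dagger B))" "j < dim_col (kron (dagger A) (dagger B))"
  then have ij: "i < m' * n'" "j < m * n" using assms by (auto simp: kron_def)
  then show "dagger (kron A B) $$ (i, j) = kron (dagger A) (dagger B) $$ (i, j)"
    using assms prod_index_decomp[OF ij(1)] prod_index_decomp[OF ij(2)]
    by (auto simp: kron_def)
qed (use assms in \<open>auto simp: kron_def\<close>)

lemma kron_vec_carrier [simp]:
  "a \<in> carrier_vec m \<Longrightarrow> b \<in> carrier_vec n \<Longrightarrow> kron_vec a b \<in> carrier_vec (m * n)"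
  by (auto simp: kron_vec_def)

lemma kron_vec_index:
  "a \<in> carrier_vec m \<Longrightarrow> b \<in> carrier_vec n \<Longrightarrow> i < m \<Longrightarrow> j < n \<Longrightarrow>
   kron_vec a b $ (i * n + j) = a $ i * b $ j"
  by (auto simp: kron_vec_def prod_index)

lemma vec_prod_eqI:
  assumes "x \<in> carrier_vec (m * n)" "y \<in> carrier_vec (m * n)"
    and "\<And>a b. a < m \<Longrightarrow> b < n \<Longrightarrow> x $ (a * n + b) = y $ (a * n + b)"
  shows "x = y"
proof (rule eq_vecI)
  fix i assume "i < dim_vec y"
  then have "i < m * n" using assms by simp
  from prod_index_decomp[OF this] show "x $ i = y $ i" using assms(3) by metis
qed (use assms in auto)

lemma braket_kron_vec:
  assumes "a \<in> carrier_vec m" "c \<in> carrier_vec m" "b \<in> carrier_vec n" "d \<in> carrier_vec n"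
  shows "braket (kron_vec a b) (kron_vec c d) = braket a c * braket b d"
  unfolding braket_eq[OF kron_vec_carrier[OF assms(2,4)]] braket_eq[OF assms(2)] braket_eq[OF assms(4)]
    sum_prod_index sum_product
  by (intro sum.cong refl) (simp add: kron_vec_index[OF assms(1,3)] kron_vec_index[OF assms(2,4)])

lemma kron_mult_vec_index:
  assumes A: "A \<in> carrier_mat m m'" and B: "B \<in> carrier_mat n n'" and x: "x \<in> carrier_vec (m' * n')"
    and ij: "i < m" "j < n"
  shows "(kron A B *\<^sub>v x) $ (i * n + j) = (\<Sum>k<m'. \<Sum>l<n'. A $$ (i, k) * B $$ (j, l) * x $ (k * n' + l))"
proof -
  have "(kron A B *\<^sub>v x) $ (i * n + j) = (\<Sum>k<m' * n'. kron A B $$ (i * n + j, k) * x $ k)"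
    by (rule mult_mat_vec_index[of _ "m * n"]) (use assms prod_index in auto)
  also have "\<dots> = (\<Sum>k<m'. \<Sum>l<n'. A $$ (i, k) * B $$ (j, l) * x $ (k * n' + l))"
    unfolding sum_prod_index using ij
    by (intro sum.cong refl) (simp add: kron_index[OF A B] prod_index)
  finally show ?thesis .
qed

lemma msum_carrier: "(\<And>M. M \<in> set Ms \<Longrightarrow> M \<in> carrier_mat n n) \<Longrightarrow> msum n Ms \<in> carrier_mat n n"
  by (induction Ms) (auto simp: msum_def)

lemma msum_Cons: "msum n (M # Ms) = M + msum n Ms"
  by (simp add: msum_def)

lemma msum_index:
  assumes "\<And>M. M \<in> set Ms \<Longrightarrow> M \<in> carrier_mat n n" "i < n" "j < n"
  shows "msum n Ms $$ (i, j) = (\<Sum>M\<leftarrow>Ms. M $$ (i, j))"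
  using assms(1)
proof (induction Ms)
  case Nil
  then show ?case using assms(2,3) by (simp add: msum_def)
next
  case (Cons M Ms)
  then show ?case using assms(2,3) msum_carrier[of Ms n] by (simp add: msum_Cons)
qed

lemma mult_msum:
  assumes "P \<in> carrier_mat n n" "\<And>M. M \<in> set Ms \<Longrightarrow> M \<in> carrier_mat n n"
  shows "P * msum n Ms = msum n (map (\<lambda>M. P * M) Ms)"
  using assms(2)
proof (induction Ms)
  case Nil
  then show ?case using assms(1) by (simp add: msum_def)
next
  case (Cons M Ms)
  have "M \<in> carrier_mat n n" "msum n Ms \<in> carrier_mat n n"
    using Cons.prems msum_carrier[of Ms n] by simp_all
  then show ?case using Cons.IH[OF Cons.prems[OF list.set_intros(2)]] assms(1)
    by (simp add: msum_Cons mult_add_distrib_mat[of _ n n])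
qed

lemma mtrace_msum:
  assumes "\<And>M. M \<in> set Ms \<Longrightarrow> M \<in> carrier_mat n n"
  shows "mtrace (msum n Ms) = (\<Sum>M\<leftarrow>Ms. mtrace M)"
  using assms
proof (induction Ms)
  case Nil
  then show ?case by (simp add: msum_def mtrace_def)
next
  case (Cons M Ms)
  have "M \<in> carrier_mat n n" "msum n Ms \<in> carrier_mat n n"
    using Cons.prems msum_carrier[of Ms n] by simp_all
  then show ?case using Cons.IH[OF Cons.prems[OF list.set_intros(2)]] by (simp add: msum_Cons mtrace_def sum.distrib)
qed

lemma braket_msum:
  assumes "\<And>M. M \<in> set Ms \<Longrightarrow> M \<in> carrier_mat n n" "x \<in> carrier_vec n"
  shows "braket y (msum n Ms *\<^sub>v x) = (\<Sum>M\<leftarrow>Ms. braket y (M *\<^sub>v x))"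
  using assms(1)
proof (induction Ms)
  case Nil
  have "0\<^sub>m n n *\<^sub>v x = 0\<^sub>v n" using assms(2) by (intro eq_vecI) auto
  then show ?case by (simp add: msum_def)
next
  case (Cons M Ms)
  have "M \<in> carrier_mat n n" "msum n Ms \<in> carrier_mat n n"
    using Cons.prems msum_carrier[of Ms n] by simp_all
  then show ?case using Cons.IH[OF Cons.prems[OF list.set_intros(2)]] assms(2)
    by (simp add: msum_Cons add_mult_distrib_mat_vec[of _ n n] braket_add_right[of _ n])
qed

definition outer :: "complex vec \<Rightarrow> complex vec \<Rightarrow> complex mat" where
  "outer u v = mat (dim_vec u) (dim_vec v) (\<lambda>(i, j). u $ i * cnj (v $ j))"

lemma outer_carrier [simp]: "u \<in> carrier_vec m \<Longrightarrow> v \<in> carrier_vec n \<Longrightarrow> outer u v \<in> carrier_mat m n"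
  by (auto simp: outer_def)

lemma ketbra_eq_outer: "ketbra v = outer v v"
  by (simp add: ketbra_def outer_def)

lemma ketbra_carrier [simp]: "v \<in> carrier_vec n \<Longrightarrow> ketbra v \<in> carrier_mat n n"
  by (simp add: ketbra_eq_outer)

lemma mult_outer:
  assumes "A \<in> carrier_mat m n" "u \<in> carrier_vec n" "v \<in> carrier_vec k"
  shows "A * outer u v = outer (A *\<^sub>v u) v"
  using assms by (intro eq_matI) (auto simp: outer_def scalar_prod_def sum_distrib_right mult.assoc)

lemma outer_mult_dagger:
  assumes "B \<in> carrier_mat m n" "u \<in> carrier_vec k" "v \<in> carrier_vec n"
  shows "outer u v * dagger B = outer u (B *\<^sub>v v)"
  using assms by (intro eq_matI) (auto simp: outer_def scalar_prod_def sum_distrib_left mult_ac)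

lemma outer_mult_vec:
  assumes "u \<in> carrier_vec m" "v \<in> carrier_vec n" "x \<in> carrier_vec n"
  shows "outer u v *\<^sub>v x = braket v x \<cdot>\<^sub>v u"
proof (rule eq_vecI)
  fix i assume "i < dim_vec (braket v x \<cdot>\<^sub>v u)"
  then have i: "i < m" using assms by simp
  then show "(outer u v *\<^sub>v x) $ i = (braket v x \<cdot>\<^sub>v u) $ i"
    using assms unfolding mult_mat_vec_index[OF outer_carrier[OF assms(1,2)] assms(3) i]
    by (simp add: outer_def braket_eq[of _ n] sum_distrib_left mult_ac)
qed (use assms in \<open>auto simp: outer_def\<close>)

lemma conj_ketbra:
  "K \<in> carrier_mat m n \<Longrightarrow> v \<in> carrier_vec n \<Longrightarrow> K * ketbra v * dagger K = ketbra (K *\<^sub>v v)"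
  unfolding ketbra_eq_outer by (subst mult_outer) (auto intro!: outer_mult_dagger mult_mat_vec_carrier)

lemma mtrace_outer: "u \<in> carrier_vec n \<Longrightarrow> v \<in> carrier_vec n \<Longrightarrow> mtrace (outer u v) = braket v u"
  by (simp add: mtrace_def outer_def braket_eq[of _ n] mult.commute)

lemma mtrace_mult_ketbra:
  "P \<in> carrier_mat n n \<Longrightarrow> v \<in> carrier_vec n \<Longrightarrow> mtrace (P * ketbra v) = braket v (P *\<^sub>v v)"
  unfolding ketbra_eq_outer by (subst mult_outer) (auto intro!: mtrace_outer mult_mat_vec_carrier)

lemma projector_carrier: "projector n P \<Longrightarrow> P \<in> carrier_mat n n"
  by (simp add: projector_def)

lemma projector_mult_vec_idem:
  "projector n P \<Longrightarrow> x \<in> carrier_vec n \<Longrightarrow> P *\<^sub>v (P *\<^sub>v x) = P *\<^sub>v x"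
  by (metis assoc_mult_mat_vec projector_def)

lemma braket_projector:
  assumes "projector n P" "x \<in> carrier_vec n"
  shows "braket x (P *\<^sub>v x) = braket (P *\<^sub>v x) (P *\<^sub>v x)"
  using assms braket_mult_mat_right[of P n n "P *\<^sub>v x" x] braket_mult_mat_right[of P n n x x]
    projector_mult_vec_idem[OF assms]
  by (auto simp: projector_def hermitian_def)

lemma braket_projector_compl:
  assumes "projector n P" "x \<in> carrier_vec n"
  shows "braket (x - P *\<^sub>v x) (x - P *\<^sub>v x) = braket x x - braket x (P *\<^sub>v x)"
proof -
  have P: "P *\<^sub>v x \<in> carrier_vec n" using assms by (auto simp: projector_def)
  have "braket (P *\<^sub>v x) x = braket x (P *\<^sub>v x)"
    using braket_mult_mat_right[of P n n x x] assms by (auto simp: projector_def hermitian_def)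
  then show ?thesis using braket_projector[OF assms] assms(2) P
    by (simp add: braket_minus_left[of _ n] braket_minus_right[of _ n])
qed

lemma braket_projector_le:
  assumes "projector n P" "x \<in> carrier_vec n"
  shows "Re (braket x (P *\<^sub>v x)) \<le> Re (braket x x)"
  using Re_braket_self_nonneg[of "x - P *\<^sub>v x"] braket_projector_compl[OF assms] by simp

lemma projector_fixes:
  assumes "projector n P" "x \<in> carrier_vec n" "Re (braket x (P *\<^sub>v x)) \<ge> Re (braket x x)"
  shows "P *\<^sub>v x = x"
proof -
  have P: "P *\<^sub>v x \<in> carrier_vec n" using assms by (auto simp: projector_def)
  have "Re (braket (x - P *\<^sub>v x) (x - P *\<^sub>v x)) = 0"
    using Re_braket_self_nonneg[of "x - P *\<^sub>v x"] braket_projector_compl[OF assms(1,2)] assms(3) by simp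
  then have "braket (x - P *\<^sub>v x) (x - P *\<^sub>v x) = 0" by (metis of_real_0 of_real_Re_braket_self)
  then have "x - P *\<^sub>v x = 0\<^sub>v n" using braket_self_eq_0_iff[of "x - P *\<^sub>v x" n] assms(2) P by simp
  then show ?thesis by (rule eq_of_minus_vec_eq_0[OF assms(2) P, symmetric])
qed

lemma projector_one_minus:
  assumes "projector n P"
  shows "projector n (1\<^sub>m n - P)"
proof -
  have P: "P \<in> carrier_mat n n" "dagger P = P" "P * P = P"
    using assms by (auto simp: projector_def hermitian_def)
  have "dagger (1\<^sub>m n - P) = 1\<^sub>m n - P"
  proof (rule eq_matI)
    fix i j assume "i < dim_row (1\<^sub>m n - P)" "j < dim_col (1\<^sub>m n - P)"
    then have ij: "i < n" "j < n" using P by auto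
    have "cnj (P $$ (j, i)) = dagger P $$ (i, j)" using P(1) ij by simp
    then have "cnj (P $$ (j, i)) = P $$ (i, j)" unfolding P(2) .
    then show "dagger (1\<^sub>m n - P) $$ (i, j) = (1\<^sub>m n - P) $$ (i, j)" using P ij by auto
  qed (use P in auto)
  moreover have "(1\<^sub>m n - P) * (1\<^sub>m n - P) = 1\<^sub>m n - P"
  proof -
    have "(1\<^sub>m n - P) * (1\<^sub>m n - P) = (1\<^sub>m n - P) * 1\<^sub>m n - (1\<^sub>m n - P) * P"
      using P by (intro mult_minus_distrib_mat) auto
    also have "(1\<^sub>m n - P) * P = 1\<^sub>m n * P - P * P"
      using P by (intro minus_mult_distrib_mat) auto
    finally show ?thesis using P by (auto intro!: eq_matI)
  qed
  ultimately show ?thesis using P by (auto simp: projector_def hermitian_def)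
qed

lemma projector_sum:
  assumes I: "finite I" and proj: "\<And>s. s \<in> I \<Longrightarrow> projector n (K s)"
    and orth: "\<And>s t. s \<in> I \<Longrightarrow> t \<in> I \<Longrightarrow> s \<noteq> t \<Longrightarrow> K s * K t = 0\<^sub>m n n"
  shows "projector n (mat n n (\<lambda>ij. \<Sum>s\<in>I. K s $$ ij))" (is "projector n ?P")
proof -
  have c: "K s \<in> carrier_mat n n" if "s \<in> I" for s using proj[OF that] by (simp add: projector_def)
  have "hermitian ?P"
    unfolding hermitian_def
  proof (rule eq_matI)
    fix i j assume "i < dim_row ?P" "j < dim_col ?P"
    then have ij: "i < n" "j < n" by auto
    have "cnj (K s $$ (j, i)) = K s $$ (i, j)" if "s \<in> I" for s
    proof -
      have "cnj (K s $$ (j, i)) = dagger (K s) $$ (i, j)" using c[OF that] ij by simp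
      then show ?thesis using proj[OF that] by (simp add: projector_def hermitian_def)
    qed
    then show "dagger ?P $$ (i, j) = ?P $$ (i, j)" using ij by simp
  qed auto
  moreover have "?P * ?P = ?P"
  proof (rule eq_matI)
    fix i j assume "i < dim_row ?P" "j < dim_col ?P"
    then have ij: "i < n" "j < n" by auto
    have "(?P * ?P) $$ (i, j) = (\<Sum>l<n. ?P $$ (i, l) * ?P $$ (l, j))"
      by (rule mult_mat_index[of _ n n _ n]) (use ij in auto)
    also have "\<dots> = (\<Sum>l<n. \<Sum>s\<in>I. \<Sum>t\<in>I. K s $$ (i, l) * K t $$ (l, j))"
      using ij by (intro sum.cong refl) (simp add: sum_product)
    also have "\<dots> = (\<Sum>s\<in>I. \<Sum>t\<in>I. \<Sum>l<n. K s $$ (i, l) * K t $$ (l, j))"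
      by (subst sum.swap, intro sum.cong refl, rule sum.swap)
    also have "\<dots> = (\<Sum>s\<in>I. \<Sum>t\<in>I. (K s * K t) $$ (i, j))"
      by (intro sum.cong refl mult_mat_index[OF c c ij, symmetric])
    also have "\<dots> = (\<Sum>s\<in>I. (K s * K s) $$ (i, j))"
    proof (intro sum.cong refl)
      fix s assume "s \<in> I"
      then show "(\<Sum>t\<in>I. (K s * K t) $$ (i, j)) = (K s * K s) $$ (i, j)"
        using I ij orth[of s] by (subst sum.mono_neutral_right[of _ "{s}"]) fastforce+
    qed
    also have "\<dots> = ?P $$ (i, j)" using ij proj by (simp add: projector_def)
    finally show "(?P * ?P) $$ (i, j) = ?P $$ (i, j)" .
  qed auto
  ultimately show ?thesis by (simp add: projector_def)
qed

lemma proj_meas_orthogonal: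
  assumes meas: "proj_meas n Ps" and ij: "i < length Ps" "j < length Ps" "i \<noteq> j"
  shows "Ps ! j * Ps ! i = 0\<^sub>m n n"
proof -
  have proj: "projector n P" if "P \<in> set Ps" for P using meas that by (simp add: proj_meas_def)
  have pi: "projector n (Ps ! i)" and pj: "projector n (Ps ! j)" using proj ij by auto
  have c: "P \<in> carrier_mat n n" if "P \<in> set Ps" for P using proj[OF that] by (simp add: projector_def)
  have zero: "Ps ! j *\<^sub>v (Ps ! i *\<^sub>v x) = 0\<^sub>v n" if x: "x \<in> carrier_vec n" for x
  proof -
    define y where "y = Ps ! i *\<^sub>v x"
    have y: "y \<in> carrier_vec n" using pi x by (auto simp: y_def projector_def)
    have yi: "Ps ! i *\<^sub>v y = y" unfolding y_def by (rule projector_mult_vec_idem[OF pi x])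
    define f where "f k = Re (braket (Ps ! k *\<^sub>v y) (Ps ! k *\<^sub>v y))" for k
    have "Re (braket y y) = Re (braket y (msum n Ps *\<^sub>v y))" using meas y by (simp add: proj_meas_def)
    also have "\<dots> = Re (\<Sum>P\<leftarrow>Ps. braket y (P *\<^sub>v y))" using braket_msum[of Ps n y y] c y by simp
    also have "\<dots> = (\<Sum>k<length Ps. f k)"
      unfolding sum_list_sum_nth f_def Re_sum length_map lessThan_atLeast0 using y proj
      by (intro sum.cong) (auto simp: braket_projector[of n])
    also have "\<dots> \<ge> (\<Sum>k\<in>{i, j}. f k)"
      using ij by (intro sum_mono2) (auto simp: f_def Re_braket_self_nonneg)
    finally have "f i + f j \<le> Re (braket y y)" using ij by simp
    moreover have "f i = Re (braket y y)" by (simp add: f_def yi)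
    ultimately have "f j = 0" using Re_braket_self_nonneg[of "Ps ! j *\<^sub>v y"] by (simp add: f_def)
    then have "braket (Ps ! j *\<^sub>v y) (Ps ! j *\<^sub>v y) = 0"
      unfolding f_def by (metis of_real_0 of_real_Re_braket_self)
    then show ?thesis using braket_self_eq_0_iff[of "Ps ! j *\<^sub>v y" n] pj y by (auto simp: y_def projector_def)
  qed
  show ?thesis
  proof (rule eq_matI)
    fix k l assume "k < dim_row (0\<^sub>m n n)" "l < dim_col (0\<^sub>m n n)"
    then have kl: "k < n" "l < n" by auto
    have "col (Ps ! i) l = Ps ! i *\<^sub>v col (Ps ! i) l"
      using pi kl col_mult2[of "Ps ! i" n n "Ps ! i" n l] by (simp add: projector_def)
    then have "col (Ps ! j * Ps ! i) l = Ps ! j *\<^sub>v (Ps ! i *\<^sub>v col (Ps ! i) l)"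
      using pi pj kl col_mult2[of "Ps ! j" n n "Ps ! i" n l] by (simp add: projector_def)
    also have "\<dots> = 0\<^sub>v n" by (rule zero) (use pi in \<open>auto simp: projector_def\<close>)
    finally have "col (Ps ! j * Ps ! i) l $ k = 0" using kl by simp
    then show "(Ps ! j * Ps ! i) $$ (k, l) = 0\<^sub>m n n $$ (k, l)"
      using pi pj kl by (auto simp: projector_def)
  qed (use pi pj in \<open>auto simp: projector_def\<close>)
qed

lemma projector_kron:
  assumes "projector m A" "projector n B"
  shows "projector (m * n) (kron A B)"
  using assms kron_mult[of A m m B n n A m B n] dagger_kron[of A m m B n n]
  by (auto simp: projector_def hermitian_def)

lemma kron_zero: "A \<in> carrier_mat m m' \<Longrightarrow> kron A (0\<^sub>m n n') = 0\<^sub>m (m * n) (m' * n')"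
  "B \<in> carrier_mat n n' \<Longrightarrow> kron (0\<^sub>m m m') B = 0\<^sub>m (m * n) (m' * n')"
  using prod_index_decomp by (auto simp: kron_def intro!: eq_matI)

lemma projector_test_projector:
  assumes "valid_test dA dB t"
  shows "projector (dA * dB) (test_projector dA dB t)"
proof -
  obtain As Bs S where t: "t = ((As, Bs), S)" by (metis surj_pair)
  have A: "proj_meas dA As" and B: "proj_meas dB Bs"
    and S: "S \<subseteq> {..<length As} \<times> {..<length Bs}"
    using assms by (auto simp: valid_test_def local_proj_meas_def t)
  have pA: "projector dA (As ! a)" if "a < length As" for a using A that by (simp add: proj_meas_def)
  have pB: "projector dB (Bs ! b)" if "b < length Bs" for b using B that by (simp add: proj_meas_def)
  have cA: "As ! a \<in> carrier_mat dA dA" if "a < length As" for a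
    using pA[OF that] by (simp add: projector_def)
  have cB: "Bs ! b \<in> carrier_mat dB dB" if "b < length Bs" for b
    using pB[OF that] by (simp add: projector_def)
  show ?thesis unfolding test_projector_def t fst_conv snd_conv
  proof (rule projector_sum)
    show "finite S" using S by (rule finite_subset) auto
    show "projector (dA * dB) (kron (As ! fst s) (Bs ! snd s))" if "s \<in> S" for s
      using that S pA pB by (intro projector_kron) auto
    show "kron (As ! fst s) (Bs ! snd s) * kron (As ! fst t) (Bs ! snd t) = 0\<^sub>m (dA * dB) (dA * dB)"
      if "s \<in> S" "t \<in> S" "s \<noteq> t" for s t
    proof -
      have st: "fst s < length As" "snd s < length Bs" "fst t < length As" "snd t < length Bs"
        using that S by auto
      have "fst s \<noteq> fst t \<or> snd s \<noteq> snd t" using that(3) by (simp add: prod_eq_iff)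
      then show ?thesis
        unfolding kron_mult[OF cA[OF st(1)] cB[OF st(2)] cA[OF st(3)] cB[OF st(4)]]
        using st cA cB proj_meas_orthogonal[OF A st(3,1)] proj_meas_orthogonal[OF B st(4,2)]
        by (auto intro!: kron_zero mult_carrier_mat)
    qed
  qed
qed

lemma proj_meas_binary:
  assumes "projector n P"
  shows "proj_meas n [P, 1\<^sub>m n - P]"
  using assms projector_one_minus[OF assms] 
  by (auto simp: proj_meas_def msum_def projector_def intro!: eq_matI)

definition proj_onto :: "complex vec \<Rightarrow> complex mat" where
  "proj_onto v = (1 / braket v v) \<cdot>\<^sub>m ketbra v"

lemma proj_onto_carrier [simp]: "v \<in> carrier_vec n \<Longrightarrow> proj_onto v \<in> carrier_mat n n"
  by (simp add: proj_onto_def)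

lemma smult_mat_mult_vec:
  fixes A :: "complex mat"
  assumes "A \<in> carrier_mat m n" "x \<in> carrier_vec n"
  shows "(c \<cdot>\<^sub>m A) *\<^sub>v x = c \<cdot>\<^sub>v (A *\<^sub>v x)"
  using assms by (intro eq_vecI) (auto simp: scalar_prod_def sum_distrib_left mult.assoc)

lemma proj_onto_mult_vec:
  assumes "v \<in> carrier_vec n" "x \<in> carrier_vec n"
  shows "proj_onto v *\<^sub>v x = (braket v x / braket v v) \<cdot>\<^sub>v v"
  using assms outer_mult_vec[OF assms(1,1,2)]
  by (simp add: proj_onto_def ketbra_eq_outer smult_mat_mult_vec[of _ n n] smult_smult_assoc)

text \<open>The case \<open>v = 0\<close> is included: then \<open>proj_onto v = 0\<close>, since \<open>1 / 0 = 0\<close>.\<close>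
lemma proj_onto_fixes:
  assumes "v \<in> carrier_vec n"
  shows "proj_onto v *\<^sub>v v = v"
  using assms braket_self_eq_0_iff[OF assms] by (cases "v = 0\<^sub>v n") (auto simp: proj_onto_mult_vec[of _ n])

lemma proj_onto_mult_proj_onto:
  assumes "u \<in> carrier_vec n" "v \<in> carrier_vec n"
  shows "proj_onto u * proj_onto v = (1 / braket v v) \<cdot>\<^sub>m outer (proj_onto u *\<^sub>v v) v"
  using mult_outer[of "proj_onto u" n n v v n] assms
  by (simp add: proj_onto_def[of v] ketbra_eq_outer mult_smult_distrib[of _ n n _ n])

lemma projector_proj_onto:
  assumes v: "v \<in> carrier_vec n"
  shows "projector n (proj_onto v)"
proof -
  have "dagger (proj_onto v) = proj_onto v"
    using v cnj_braket[OF v v] by (intro eq_matI) (auto simp: proj_onto_def ketbra_def)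
  moreover have "proj_onto v * proj_onto v = proj_onto v"
    using proj_onto_mult_proj_onto[OF v v] proj_onto_fixes[OF v] by (simp add: proj_onto_def ketbra_eq_outer)
  ultimately show ?thesis using v by (simp add: projector_def hermitian_def)
qed

lemma proj_onto_orthogonal:
  assumes "u \<in> carrier_vec n" "v \<in> carrier_vec n" "braket u v = 0"
  shows "proj_onto u * proj_onto v = 0\<^sub>m n n"
  unfolding proj_onto_mult_proj_onto[OF assms(1,2)] proj_onto_mult_vec[OF assms(1,2)]
  using assms by (intro eq_matI) (auto simp: outer_def)

subsection \<open>Two tests for a bipartite pure state\<close>

definition partial_left :: "nat \<Rightarrow> nat \<Rightarrow> complex vec \<Rightarrow> complex vec \<Rightarrow> complex vec" where
  "partial_left m n u x = vec n (\<lambda>b. \<Sum>a<m. cnj (u $ a) * x $ (a * n + b))"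

definition partial_right :: "nat \<Rightarrow> nat \<Rightarrow> complex vec \<Rightarrow> complex vec \<Rightarrow> complex vec" where
  "partial_right m n c x = vec m (\<lambda>a. \<Sum>b<n. cnj (c $ b) * x $ (a * n + b))"

lemma partial_left_carrier [simp]: "partial_left m n u x \<in> carrier_vec n"
  by (simp add: partial_left_def)

lemma partial_right_carrier [simp]: "partial_right m n c x \<in> carrier_vec m"
  by (simp add: partial_right_def)

lemma kron_proj_onto_right_mult_vec:
  assumes A: "A \<in> carrier_mat m m" and c: "c \<in> carrier_vec n" "braket c c = 1"
    and x: "x \<in> carrier_vec (m * n)" and ij: "i < m" "j < n"
  shows "(kron A (proj_onto c) *\<^sub>v x) $ (i * n + j) = (A *\<^sub>v partial_right m n c x) $ i * c $ j"
proof -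
  have "(kron A (proj_onto c) *\<^sub>v x) $ (i * n + j) =
      (\<Sum>k<m. \<Sum>l<n. A $$ (i, k) * proj_onto c $$ (j, l) * x $ (k * n + l))"
    by (rule kron_mult_vec_index[OF A _ x ij]) (use c in simp)
  also have "\<dots> = (\<Sum>k<m. A $$ (i, k) * partial_right m n c x $ k) * c $ j"
    unfolding sum_distrib_right
  proof (rule sum.cong[OF refl])
    fix k assume "k \<in> {..<m}"
    then show "(\<Sum>l<n. A $$ (i, k) * proj_onto c $$ (j, l) * x $ (k * n + l)) =
        A $$ (i, k) * partial_right m n c x $ k * c $ j"
      using c ij by (simp add: proj_onto_def ketbra_def partial_right_def sum_distrib_left sum_distrib_right mult_ac)
  qed
  also have "(\<Sum>k<m. A $$ (i, k) * partial_right m n c x $ k) = (A *\<^sub>v partial_right m n c x) $ i"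
    by (rule mult_mat_vec_index[OF A _ ij(1), symmetric]) simp
  finally show ?thesis .
qed

lemma kron_proj_onto_left_mult_vec:
  assumes B: "B \<in> carrier_mat n n" and u: "u \<in> carrier_vec m"
    and x: "x \<in> carrier_vec (m * n)" and ij: "i < m" "j < n"
  shows "(kron (proj_onto u) B *\<^sub>v x) $ (i * n + j) =
    u $ i / braket u u * (B *\<^sub>v partial_left m n u x) $ j"
proof -
  have "(kron (proj_onto u) B *\<^sub>v x) $ (i * n + j) =
      (\<Sum>k<m. \<Sum>l<n. proj_onto u $$ (i, k) * B $$ (j, l) * x $ (k * n + l))"
    by (rule kron_mult_vec_index[OF _ B x ij]) (use u in simp)
  also have "\<dots> = (\<Sum>l<n. \<Sum>k<m. proj_onto u $$ (i, k) * B $$ (j, l) * x $ (k * n + l))"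
    by (rule sum.swap)
  also have "\<dots> = u $ i / braket u u * (\<Sum>l<n. B $$ (j, l) * partial_left m n u x $ l)"
    unfolding sum_distrib_left
  proof (rule sum.cong[OF refl])
    fix l assume "l \<in> {..<n}"
    then show "(\<Sum>k<m. proj_onto u $$ (i, k) * B $$ (j, l) * x $ (k * n + l)) =
        u $ i / braket u u * (B $$ (j, l) * partial_left m n u x $ l)"
      using u ij by (simp add: proj_onto_def ketbra_def partial_left_def sum_distrib_left mult_ac)
  qed
  also have "(\<Sum>l<n. B $$ (j, l) * partial_left m n u x $ l) = (B *\<^sub>v partial_left m n u x) $ j"
    by (rule mult_mat_vec_index[OF B _ ij(2), symmetric]) simp
  finally show ?thesis .
qed

lemma partial_right_expansion:
  assumes c: "orthonormal n n c" and ab: "a < m" "b < n"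
  shows "x $ (a * n + b) = (\<Sum>k<n. partial_right m n (c k) x $ a * c k $ b)"
proof -
  have "(\<Sum>k<n. partial_right m n (c k) x $ a * c k $ b) =
      (\<Sum>k<n. \<Sum>l<n. c k $ b * cnj (c k $ l) * x $ (a * n + l))"
    using ab by (simp add: partial_right_def sum_distrib_left sum_distrib_right mult_ac)
  also have "\<dots> = (\<Sum>l<n. (\<Sum>k<n. c k $ b * cnj (c k $ l)) * x $ (a * n + l))"
    by (subst sum.swap) (simp add: sum_distrib_right)
  also have "\<dots> = (\<Sum>l<n. (if b = l then 1 else 0) * x $ (a * n + l))"
    using orthonormal_basis_completeness[OF c ab(2)] by (intro sum.cong) auto
  finally show ?thesis using sum_delta_mult[OF ab(2), of "\<lambda>l. x $ (a * n + l)"] by simp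
qed

lemma schmidt_basis_exists:
  assumes "\<phi> \<in> carrier_vec (m * n)"
  shows "\<exists>c. orthonormal n n c \<and> (\<forall>k<n. \<forall>l<n. k \<noteq> l \<longrightarrow>
    braket (partial_right m n (c k) \<phi>) (partial_right m n (c l) \<phi>) = 0)"
proof -
  define H where "H = mat n n (\<lambda>(b, b'). \<Sum>a<m. \<phi> $ (a * n + b) * cnj (\<phi> $ (a * n + b')))"
  have H: "H \<in> carrier_mat n n" by (simp add: H_def)
  have "hermitian H" unfolding hermitian_def
    by (intro eq_matI) (auto simp: H_def mult.commute)
  then obtain c d where c: "orthonormal n n c" "\<forall>i<n. H *\<^sub>v c i = complex_of_real (d i) \<cdot>\<^sub>v c i"
    using hermitian_spectral[OF H] by blast
  have "braket (partial_right m n (c k) \<phi>) (partial_right m n (c l) \<phi>) = 0"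
    if kl: "k < n" "l < n" "k \<noteq> l" for k l
  proof -
    have cc: "c k \<in> carrier_vec n" "c l \<in> carrier_vec n" using c(1) kl by (auto simp: orthonormal_def)
    have "braket (partial_right m n (c k) \<phi>) (partial_right m n (c l) \<phi>) =
        (\<Sum>a<m. \<Sum>b'<n. \<Sum>b<n. cnj (c l $ b) * (\<phi> $ (a * n + b) * cnj (\<phi> $ (a * n + b')) * c k $ b'))"
      by (simp add: braket_eq[of _ m] partial_right_def sum_product mult_ac)
    also have "\<dots> = (\<Sum>b<n. \<Sum>b'<n. \<Sum>a<m. cnj (c l $ b) * (\<phi> $ (a * n + b) * cnj (\<phi> $ (a * n + b')) * c k $ b'))"
      by (subst sum.swap, subst (2) sum.swap, subst sum.swap) simp
    also have "\<dots> = (\<Sum>b<n. cnj (c l $ b) * (\<Sum>b'<n. H $$ (b, b') * c k $ b'))"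
      by (intro sum.cong refl) (simp add: H_def sum_distrib_left sum_distrib_right)
    also have "\<dots> = braket (c l) (H *\<^sub>v c k)"
      using H cc by (subst braket_eq[of _ n]) (auto simp: mult_mat_vec_index[of H n n] simp del: index_mult_mat_vec)
    also have "\<dots> = 0" using c kl by (simp add: braket_smult_right orthonormal_def)
    finally show ?thesis .
  qed
  then show ?thesis using c(1) by blast
qed

lemma test_projector_carrier [simp]: "test_projector m n t \<in> carrier_mat (m * n) (m * n)"
  by (simp add: test_projector_def)

lemma test_projector_mult_vec_index:
  assumes "valid_test m n ((As, Bs), S)" "x \<in> carrier_vec (m * n)" "i < m * n"
  shows "(test_projector m n ((As, Bs), S) *\<^sub>v x) $ i = (\<Sum>s\<in>S. (kron (As ! fst s) (Bs ! snd s) *\<^sub>v x) $ i)"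
proof -
  have k: "kron (As ! fst s) (Bs ! snd s) \<in> carrier_mat (m * n) (m * n)" if "s \<in> S" for s
  proof -
    have "fst s < length As" "snd s < length Bs" using that assms(1) by (auto simp: valid_test_def)
    then show ?thesis using assms(1)
      by (intro kron_carrier) (auto simp: valid_test_def local_proj_meas_def proj_meas_def projector_def)
  qed
  have "(test_projector m n ((As, Bs), S) *\<^sub>v x) $ i =
      (\<Sum>j<m * n. \<Sum>s\<in>S. kron (As ! fst s) (Bs ! snd s) $$ (i, j) * x $ j)"
    unfolding mult_mat_vec_index[OF test_projector_carrier assms(2,3)]
    using assms(3) by (intro sum.cong refl) (simp add: test_projector_def sum_distrib_right)
  also have "\<dots> = (\<Sum>s\<in>S. (kron (As ! fst s) (Bs ! snd s) *\<^sub>v x) $ i)"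
    by (subst sum.swap) (intro sum.cong refl mult_mat_vec_index[OF k assms(2,3), symmetric])
  finally show ?thesis .
qed

lemma proj_meas_orthogonal_family:
  assumes w: "\<And>k. k < r \<Longrightarrow> w k \<in> carrier_vec n"
    and orth: "\<And>k l. k < r \<Longrightarrow> l < r \<Longrightarrow> k \<noteq> l \<Longrightarrow> braket (w k) (w l) = 0"
  shows "\<exists>R. proj_meas n (map (\<lambda>k. proj_onto (w k)) [0..<r] @ [R])"
proof -
  define Q where "Q = mat n n (\<lambda>ij. \<Sum>k<r. proj_onto (w k) $$ ij)"
  have Q: "projector n Q" unfolding Q_def
    using w orth by (intro projector_sum) (auto intro!: projector_proj_onto proj_onto_orthogonal)
  let ?Ps = "map (\<lambda>k. proj_onto (w k)) [0..<r] @ [1\<^sub>m n - Q]"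
  have c: "P \<in> carrier_mat n n" if "P \<in> set ?Ps" for P
    using that w projector_carrier[OF projector_one_minus[OF Q]] by auto
  have "msum n ?Ps = 1\<^sub>m n"
  proof (rule eq_matI)
    fix i j assume "i < dim_row (1\<^sub>m n)" "j < dim_col (1\<^sub>m n)"
    then have ij: "i < n" "j < n" by auto
    have "msum n ?Ps $$ (i, j) = (\<Sum>P\<leftarrow>?Ps. P $$ (i, j))" by (rule msum_index[OF c ij])
    also have "\<dots> = Q $$ (i, j) + (1\<^sub>m n - Q) $$ (i, j)"
      using ij by (simp add: comp_def interv_sum_list_conv_sum_set_nat Q_def lessThan_atLeast0)
    also have "\<dots> = 1\<^sub>m n $$ (i, j)" using ij by (simp add: Q_def)
    finally show "msum n ?Ps $$ (i, j) = 1\<^sub>m n $$ (i, j)" .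
  qed (use msum_carrier[of ?Ps n] c in auto)
  then have "proj_meas n ?Ps"
    using w projector_one_minus[OF Q] by (auto simp: proj_meas_def intro!: projector_proj_onto)
  then show ?thesis by blast
qed

lemma proj_meas_orthonormal_basis:
  assumes c: "orthonormal n n c"
  shows "proj_meas n (map (\<lambda>k. proj_onto (c k)) [0..<n])"
proof -
  let ?Ps = "map (\<lambda>k. proj_onto (c k)) [0..<n]"
  have cc: "c k \<in> carrier_vec n" "braket (c k) (c k) = 1" if "k < n" for k
    using c that by (auto simp: orthonormal_def)
  have car: "P \<in> carrier_mat n n" if "P \<in> set ?Ps" for P using that cc by auto
  have "msum n ?Ps = 1\<^sub>m n"
  proof (rule eq_matI)
    fix i j assume "i < dim_row (1\<^sub>m n)" "j < dim_col (1\<^sub>m n)"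
    then have ij: "i < n" "j < n" by auto
    have "msum n ?Ps $$ (i, j) = (\<Sum>P\<leftarrow>?Ps. P $$ (i, j))" by (rule msum_index[OF car ij])
    also have "\<dots> = (\<Sum>k<n. proj_onto (c k) $$ (i, j))"
      by (simp add: comp_def interv_sum_list_conv_sum_set_nat lessThan_atLeast0)
    also have "\<dots> = (\<Sum>k<n. c k $ i * cnj (c k $ j))"
    proof (intro sum.cong refl)
      fix k assume "k \<in> {..<n}"
      then show "proj_onto (c k) $$ (i, j) = c k $ i * cnj (c k $ j)"
        using cc[of k] ij by (simp add: proj_onto_def ketbra_def)
    qed
    also have "\<dots> = 1\<^sub>m n $$ (i, j)" using orthonormal_basis_completeness[OF c ij] ij by simp
    finally show "msum n ?Ps $$ (i, j) = 1\<^sub>m n $$ (i, j)" .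
  qed (use msum_carrier[of ?Ps n] car in auto)
  then show ?thesis using cc by (auto simp: proj_meas_def intro!: projector_proj_onto)
qed

lemma correlation_test_exists:
  assumes c: "orthonormal n n c" and w: "\<And>k. k < n \<Longrightarrow> w k \<in> carrier_vec m"
    and orth: "\<And>k l. k < n \<Longrightarrow> l < n \<Longrightarrow> k \<noteq> l \<Longrightarrow> braket (w k) (w l) = 0"
  shows "\<exists>t. valid_test m n t \<and> (\<forall>x\<in>carrier_vec (m * n). \<forall>a<m. \<forall>b<n.
    (test_projector m n t *\<^sub>v x) $ (a * n + b) =
    (\<Sum>k<n. (proj_onto (w k) *\<^sub>v partial_right m n (c k) x) $ a * c k $ b))"
proof -
  obtain R where R: "proj_meas m (map (\<lambda>k. proj_onto (w k)) [0..<n] @ [R])"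
    using proj_meas_orthogonal_family[of n w m] w orth by blast
  define As where "As = map (\<lambda>k. proj_onto (w k)) [0..<n] @ [R]"
  define Bs where "Bs = map (\<lambda>k. proj_onto (c k)) [0..<n]"
  define S where "S = (\<lambda>k. (k, k)) ` {..<n}"
  have Ak: "As ! k = proj_onto (w k)" if "k < n" for k using that by (simp add: As_def nth_append)
  have Bk: "Bs ! k = proj_onto (c k)" if "k < n" for k using that by (simp add: Bs_def)
  have valid: "valid_test m n ((As, Bs), S)"
    using R proj_meas_orthonormal_basis[OF c]
    by (auto simp: valid_test_def local_proj_meas_def As_def Bs_def S_def)
  have "(test_projector m n ((As, Bs), S) *\<^sub>v x) $ (a * n + b) =
      (\<Sum>k<n. (proj_onto (w k) *\<^sub>v partial_right m n (c k) x) $ a * c k $ b)"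
    if x: "x \<in> carrier_vec (m * n)" and ab: "a < m" "b < n" for x a b
  proof -
    have "(test_projector m n ((As, Bs), S) *\<^sub>v x) $ (a * n + b) =
        (\<Sum>s\<in>S. (kron (As ! fst s) (Bs ! snd s) *\<^sub>v x) $ (a * n + b))"
      by (rule test_projector_mult_vec_index[OF valid x prod_index(1)[OF ab]])
    also have "\<dots> = (\<Sum>k<n. (kron (As ! k) (Bs ! k) *\<^sub>v x) $ (a * n + b))"
      unfolding S_def by (subst sum.reindex) (auto simp: inj_on_def)
    also have "\<dots> = (\<Sum>k<n. (proj_onto (w k) *\<^sub>v partial_right m n (c k) x) $ a * c k $ b)"
    proof (intro sum.cong refl)
      fix k assume "k \<in> {..<n}"
      then have k: "k < n" by simp
      show "(kron (As ! k) (Bs ! k) *\<^sub>v x) $ (a * n + b) =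
          (proj_onto (w k) *\<^sub>v partial_right m n (c k) x) $ a * c k $ b"
        unfolding Ak[OF k] Bk[OF k] using c w k x ab
        by (intro kron_proj_onto_right_mult_vec) (auto simp: orthonormal_def)
    qed
    finally show ?thesis .
  qed
  then show ?thesis using valid by blast
qed

lemma conditional_test_exists:
  assumes u: "u \<in> carrier_vec m" and v: "v \<in> carrier_vec n"
  shows "\<exists>t. valid_test m n t \<and> (\<forall>x\<in>carrier_vec (m * n).
    test_projector m n t *\<^sub>v x = x - kron (proj_onto u) (1\<^sub>m n - proj_onto v) *\<^sub>v x)"
proof -
  define P where "P = proj_onto u"
  define Q where "Q = proj_onto v"
  define K where "K = kron P (1\<^sub>m n - Q)"
  have P: "P \<in> carrier_mat m m" "projector m P" using projector_proj_onto[OF u] u by (auto simp: P_def)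
  have Q: "Q \<in> carrier_mat n n" "projector n Q" using projector_proj_onto[OF v] v by (auto simp: Q_def)
  have K: "K \<in> carrier_mat (m * n) (m * n)" unfolding K_def using P Q by (intro kron_carrier) auto
  define S where "S = {(0 :: nat, 0 :: nat), (1, 0), (1, 1)}"
  define t :: test where "t = (([P, 1\<^sub>m m - P], [Q, 1\<^sub>m n - Q]), S)"
  have valid: "valid_test m n t"
    using proj_meas_binary[OF P(2)] proj_meas_binary[OF Q(2)]
    by (auto simp: valid_test_def local_proj_meas_def t_def S_def)
  have T: "test_projector m n t = 1\<^sub>m (m * n) - K"
  proof (rule eq_matI)
    fix i j assume "i < dim_row (1\<^sub>m (m * n) - K)" "j < dim_col (1\<^sub>m (m * n) - K)"
    then have ij: "i < m * n" "j < m * n" using K by auto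
    note ij' = prod_index_decomp[OF ij(1)] prod_index_decomp[OF ij(2)]
    have one: "(1\<^sub>m (m * n) :: complex mat) $$ (i, j) = 1\<^sub>m m $$ (i div n, j div n) * 1\<^sub>m n $$ (i mod n, j mod n)"
      by (rule kron_index[OF one_carrier_mat one_carrier_mat ij, unfolded kron_one])
    have "test_projector m n t $$ (i, j) =
        kron P Q $$ (i, j) + kron (1\<^sub>m m - P) Q $$ (i, j) + kron (1\<^sub>m m - P) (1\<^sub>m n - Q) $$ (i, j)"
      using ij by (simp add: test_projector_def t_def S_def)
    also have "\<dots> = 1\<^sub>m (m * n) $$ (i, j) - K $$ (i, j)"
      unfolding one K_def kron_index[OF P(1) Q(1) ij] kron_index[OF P(1) minus_carrier_mat[OF Q(1)] ij]
        kron_index[OF minus_carrier_mat[OF P(1)] Q(1) ij]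
        kron_index[OF minus_carrier_mat[OF P(1)] minus_carrier_mat[OF Q(1)] ij]
      using ij' P(1) Q(1) by (simp add: algebra_simps del: index_one_mat)
    finally show "test_projector m n t $$ (i, j) = (1\<^sub>m (m * n) - K) $$ (i, j)" using ij K by simp
  qed (use K in \<open>auto simp: test_projector_def\<close>)
  have "test_projector m n t *\<^sub>v x = x - K *\<^sub>v x" if "x \<in> carrier_vec (m * n)" for x
    unfolding T using K that by (simp add: minus_mult_distrib_mat_vec[of _ "m * n" "m * n"])
  then show ?thesis using valid unfolding K_def P_def Q_def by blast
qed

lemma two_tests_exist:
  assumes \<phi>: "\<phi> \<in> carrier_vec (m * n)" and \<phi>0: "\<phi> \<noteq> 0\<^sub>v (m * n)"
  shows "\<exists>t1 t2. valid_test m n t1 \<and> valid_test m n t2 \<and>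
    test_projector m n t1 *\<^sub>v \<phi> = \<phi> \<and> test_projector m n t2 *\<^sub>v \<phi> = \<phi> \<and>
    (\<forall>x\<in>carrier_vec (m * n). test_projector m n t1 *\<^sub>v x = x \<longrightarrow> test_projector m n t2 *\<^sub>v x = x \<longrightarrow>
      (\<exists>\<gamma>. x = \<gamma> \<cdot>\<^sub>v \<phi>))"
proof -
  obtain c where c: "orthonormal n n c"
    and orth: "\<And>k l. k < n \<Longrightarrow> l < n \<Longrightarrow> k \<noteq> l \<Longrightarrow>
      braket (partial_right m n (c k) \<phi>) (partial_right m n (c l) \<phi>) = 0"
    using schmidt_basis_exists[OF \<phi>] by metis
  define w where "w k = partial_right m n (c k) \<phi>" for k
  have w: "w k \<in> carrier_vec m" for k by (simp add: w_def)
  have cc: "c k \<in> carrier_vec n" if "k < n" for k using c that by (auto simp: orthonormal_def)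
  have \<phi>_exp: "\<phi> $ (a * n + b) = (\<Sum>k<n. w k $ a * c k $ b)" if "a < m" "b < n" for a b
    unfolding w_def by (rule partial_right_expansion[OF c that])
  define u where "u = vec m (\<lambda>a. \<Sum>k<n. w k $ a)"
  have u: "u \<in> carrier_vec m" by (simp add: u_def)
  have uw: "braket u (w k) = braket (w k) (w k)" if k: "k < n" for k
  proof -
    have "braket u (w k) = (\<Sum>a<m. \<Sum>l<n. cnj (w l $ a) * w k $ a)"
      by (simp add: braket_eq[OF w] u_def sum_distrib_right)
    also have "\<dots> = (\<Sum>l<n. braket (w l) (w k))" by (subst sum.swap) (simp add: braket_eq[OF w])
    also have "\<dots> = braket (w k) (w k)"
      using k orth by (subst sum.mono_neutral_right[of _ "{k}"]) (auto simp: w_def)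
    finally show ?thesis .
  qed
  have pl: "partial_left m n u x $ b = (\<Sum>k<n. \<beta> k * braket (w k) (w k) * c k $ b)"
    if x: "\<And>a b. a < m \<Longrightarrow> b < n \<Longrightarrow> x $ (a * n + b) = (\<Sum>k<n. \<beta> k * w k $ a * c k $ b)" and b: "b < n"
    for x \<beta> b
  proof -
    have "partial_left m n u x $ b = (\<Sum>a<m. \<Sum>k<n. cnj (u $ a) * (\<beta> k * w k $ a * c k $ b))"
      using b by (simp add: partial_left_def x sum_distrib_left)
    also have "\<dots> = (\<Sum>k<n. \<beta> k * braket u (w k) * c k $ b)"
      by (subst sum.swap) (simp add: braket_eq[OF w] sum_distrib_left sum_distrib_right mult_ac)
    finally show ?thesis using uw by simp
  qed
  have bpl: "braket (c k) (partial_left m n u x) = \<beta> k * braket (w k) (w k)"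
    if x: "\<And>a b. a < m \<Longrightarrow> b < n \<Longrightarrow> x $ (a * n + b) = (\<Sum>k<n. \<beta> k * w k $ a * c k $ b)" and k: "k < n"
    for x \<beta> k
  proof -
    have "braket (c k) (partial_left m n u x) = (\<Sum>b<n. \<Sum>l<n. \<beta> l * braket (w l) (w l) * (cnj (c k $ b) * c l $ b))"
      by (simp add: braket_eq[OF partial_left_carrier] pl[OF x] sum_distrib_left mult_ac)
    also have "\<dots> = (\<Sum>l<n. \<beta> l * braket (w l) (w l) * braket (c k) (c l))"
      by (subst sum.swap) (simp add: braket_eq[OF cc] sum_distrib_left)
    also have "\<dots> = (\<Sum>l<n. (if k = l then 1 else 0) * (\<beta> l * braket (w l) (w l)))"
      using c k by (intro sum.cong) (auto simp: orthonormal_def)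
    finally show ?thesis using sum_delta_mult[OF k, of "\<lambda>l. \<beta> l * braket (w l) (w l)"] by simp
  qed
  define v where "v = partial_left m n u \<phi>"
  have v: "v \<in> carrier_vec n" by (simp add: v_def)
  have cv: "braket (c k) v = braket (w k) (w k)" if "k < n" for k
    unfolding v_def using bpl[of \<phi> "\<lambda>_. 1"] \<phi>_exp that by simp
  have u0: "u \<noteq> 0\<^sub>v m"
  proof
    assume "u = 0\<^sub>v m"
    then have "braket u (w k) = 0" for k by (simp add: braket_eq[OF w])
    then have "w k = 0\<^sub>v m" if "k < n" for k using uw[OF that] braket_self_eq_0_iff[OF w] by simp
    then have "\<phi> $ (a * n + b) = 0" if "a < m" "b < n" for a b
      using \<phi>_exp[OF that] that by simp
    then have "\<phi> = 0\<^sub>v (m * n)" by (intro vec_prod_eqI[OF \<phi>]) (auto simp: prod_index)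
    then show False using \<phi>0 by simp
  qed
  obtain i where i: "i < m" "u $ i \<noteq> 0"
    using u0 u by (metis carrier_vecD eq_vecI index_zero_vec)
  have uu: "braket u u \<noteq> 0" using u0 braket_self_eq_0_iff[OF u] by simp
  obtain t1 where t1: "valid_test m n t1"
    and t1_mult: "\<And>x a b. x \<in> carrier_vec (m * n) \<Longrightarrow> a < m \<Longrightarrow> b < n \<Longrightarrow>
      (test_projector m n t1 *\<^sub>v x) $ (a * n + b) =
      (\<Sum>k<n. (proj_onto (w k) *\<^sub>v partial_right m n (c k) x) $ a * c k $ b)"
    using correlation_test_exists[OF c, of w m] w orth
    unfolding w_def by blast
  obtain t2 where t2: "valid_test m n t2"
    and t2_mult: "\<And>x. x \<in> carrier_vec (m * n) \<Longrightarrow>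
      test_projector m n t2 *\<^sub>v x = x - kron (proj_onto u) (1\<^sub>m n - proj_onto v) *\<^sub>v x"
    using conditional_test_exists[OF u v] by blast
  define B where "B = 1\<^sub>m n - proj_onto v"
  have B: "B \<in> carrier_mat n n" using v unfolding B_def by (intro minus_carrier_mat) simp
  have Bmult: "B *\<^sub>v y = y - proj_onto v *\<^sub>v y" if "y \<in> carrier_vec n" for y
    using that v by (simp add: B_def minus_mult_distrib_mat_vec[of _ n n])
  have K: "kron (proj_onto u) B \<in> carrier_mat (m * n) (m * n)" using u B by simp
  have "test_projector m n t1 *\<^sub>v \<phi> = \<phi>"
  proof (rule vec_prod_eqI)
    fix a b assume ab: "a < m" "b < n"
    show "(test_projector m n t1 *\<^sub>v \<phi>) $ (a * n + b) = \<phi> $ (a * n + b)"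
      unfolding t1_mult[OF \<phi> ab] \<phi>_exp[OF ab] w_def[symmetric] proj_onto_fixes[OF w] ..
  qed (use \<phi> mult_mat_vec_carrier[OF test_projector_carrier \<phi>] in auto)
  moreover have "test_projector m n t2 *\<^sub>v \<phi> = \<phi>"
  proof -
    have "B *\<^sub>v v = 0\<^sub>v n" using v by (simp add: Bmult proj_onto_fixes)
    then have "kron (proj_onto u) B *\<^sub>v \<phi> = 0\<^sub>v (m * n)"
      using K \<phi> by (intro vec_prod_eqI[of _ m n])
        (auto simp: kron_proj_onto_left_mult_vec[OF B u \<phi>] v_def[symmetric] prod_index simp del: index_mult_mat_vec)
    then show ?thesis using t2_mult[OF \<phi>] \<phi> by (simp add: B_def)
  qed
  moreover have "\<exists>\<gamma>. x = \<gamma> \<cdot>\<^sub>v \<phi>" if x: "x \<in> carrier_vec (m * n)"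
    and fix1: "test_projector m n t1 *\<^sub>v x = x" and fix2: "test_projector m n t2 *\<^sub>v x = x" for x
  proof -
    define \<beta> where "\<beta> k = braket (w k) (partial_right m n (c k) x) / braket (w k) (w k)" for k
    have x_exp: "x $ (a * n + b) = (\<Sum>k<n. \<beta> k * w k $ a * c k $ b)" if ab: "a < m" "b < n" for a b
      using t1_mult[OF x ab] ab w unfolding fix1
      by (simp add: proj_onto_mult_vec[OF w] carrier_vecD[OF w] \<beta>_def)
    define y where "y = partial_left m n u x"
    have y: "y \<in> carrier_vec n" by (simp add: y_def)
    have Kx: "(kron (proj_onto u) B *\<^sub>v x) $ l = 0" if "l < m * n" for l
    proof -
      have "x $ l = (x - kron (proj_onto u) B *\<^sub>v x) $ l" using t2_mult[OF x] fix2 by (simp add: B_def)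
      then show ?thesis using that K x by simp
    qed
    have By: "B *\<^sub>v y = 0\<^sub>v n"
    proof (rule eq_vecI)
      fix j assume "j < dim_vec (0\<^sub>v n)"
      then have j: "j < n" by simp
      have "u $ i / braket u u * (B *\<^sub>v y) $ j = 0"
        using kron_proj_onto_left_mult_vec[OF B u x i(1) j] Kx[OF prod_index(1)[OF i(1) j]] by (simp add: y_def)
      then show "(B *\<^sub>v y) $ j = 0\<^sub>v n $ j" using i uu j by (simp del: index_mult_mat_vec)
    qed (use B in simp)
    define \<gamma> where "\<gamma> = braket v y / braket v v"
    have "y = proj_onto v *\<^sub>v y"
    proof (rule eq_of_minus_vec_eq_0[OF y mult_mat_vec_carrier[OF proj_onto_carrier[OF v] y]])
      show "y - proj_onto v *\<^sub>v y = 0\<^sub>v n" unfolding Bmult[OF y, symmetric] by (rule By)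
    qed
    also have "\<dots> = \<gamma> \<cdot>\<^sub>v v" unfolding \<gamma>_def by (rule proj_onto_mult_vec[OF v y])
    finally have y_eq: "y = \<gamma> \<cdot>\<^sub>v v" .
    have \<beta>\<gamma>: "\<beta> k * w k $ a = \<gamma> * w k $ a" if k: "k < n" and a: "a < m" for k a
    proof (cases "braket (w k) (w k) = 0")
      case True
      then show ?thesis using braket_self_eq_0_iff[OF w] a by simp
    next
      case False
      have "\<beta> k * braket (w k) (w k) = braket (c k) y" unfolding y_def using bpl[OF x_exp k] by simp
      also have "\<dots> = \<gamma> * braket (w k) (w k)" by (simp add: y_eq braket_smult_right cv[OF k])
      finally show ?thesis using False by simp
    qed
    have "x = \<gamma> \<cdot>\<^sub>v \<phi>"
    proof (rule vec_prod_eqI)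
      fix a b assume ab: "a < m" "b < n"
      have "x $ (a * n + b) = (\<Sum>k<n. \<gamma> * w k $ a * c k $ b)"
        unfolding x_exp[OF ab] using ab by (intro sum.cong refl) (simp add: \<beta>\<gamma>)
      also have "\<dots> = \<gamma> * \<phi> $ (a * n + b)" unfolding \<phi>_exp[OF ab] by (simp add: sum_distrib_left mult.assoc)
      finally show "x $ (a * n + b) = (\<gamma> \<cdot>\<^sub>v \<phi>) $ (a * n + b)" using \<phi> prod_index(1)[OF ab] by simp
    qed (use x \<phi> in auto)
    then show ?thesis by blast
  qed
  ultimately show ?thesis using t1 t2 by blast
qed

lemma hermitian_add:
  assumes "A \<in> carrier_mat n n" "B \<in> carrier_mat n n" "hermitian A" "hermitian B"
  shows "hermitian (A + B)"
proof -
  have "dagger (A + B) = dagger A + dagger B" using assms(1,2) by (intro eq_matI) auto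
  then show ?thesis using assms by (simp add: hermitian_def)
qed

lemma hermitian_smult_of_real: "hermitian A \<Longrightarrow> hermitian (complex_of_real p \<cdot>\<^sub>m A)"
proof -
  assume "hermitian A"
  moreover have "dagger (complex_of_real p \<cdot>\<^sub>m A) = complex_of_real p \<cdot>\<^sub>m dagger A"
    by (intro eq_matI) auto
  ultimately show ?thesis by (simp add: hermitian_def)
qed

lemma hermitian_msum:
  "(\<And>M. M \<in> set Ms \<Longrightarrow> M \<in> carrier_mat n n \<and> hermitian M) \<Longrightarrow> hermitian (msum n Ms)"
proof (induction Ms)
  case Nil
  then show ?case by (auto simp: msum_def hermitian_def intro!: eq_matI)
next
  case (Cons M Ms)
  then show ?case unfolding msum_Cons by (intro hermitian_add[of _ n] msum_carrier) auto
qed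

lemma sum_list_eq_0D:
  fixes f :: "'a \<Rightarrow> real"
  assumes "\<And>x. x \<in> set xs \<Longrightarrow> f x \<ge> 0" "sum_list (map f xs) \<le> 0" "x \<in> set xs"
  shows "f x = 0"
proof -
  have "sum_list (map f xs) = 0" using assms(1,2) by (intro antisym sum_list_nonneg) auto
  then show ?thesis using assms sum_list_nonneg_eq_0_iff[of "map f xs"] by auto
qed

lemma Re_sum_list: "Re (sum_list zs) = sum_list (map Re zs)"
  by (induction zs) auto

lemma verification_operator_eigenvector_fixed:
  assumes S: "state_verification_protocol m n \<phi> S"
    and x: "x \<in> carrier_vec (m * n)" "braket x x = 1"
    and eig: "verification_operator m n S *\<^sub>v x = complex_of_real a \<cdot>\<^sub>v x" and a: "a \<ge> 1"
    and t: "(p, t) \<in> set S"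
  shows "test_projector m n t *\<^sub>v x = x"
proof -
  have pos: "p > 0" and proj: "projector (m * n) (test_projector m n t)" if "(p, t) \<in> set S" for p t
    using that S by (auto simp: state_verification_protocol_def projector_test_projector)
  define f where "f = (\<lambda>s. fst s * (1 - Re (braket x (test_projector m n (snd s) *\<^sub>v x))))"
  have f_nonneg: "f s \<ge> 0" if "s \<in> set S" for s
  proof -
    obtain p t where s: "s = (p, t)" by (rule prod.exhaust)
    have "Re (braket x (test_projector m n t *\<^sub>v x)) \<le> 1"
      using braket_projector_le[OF proj x(1)] that x(2) by (simp add: s)
    then show ?thesis using pos that by (simp add: f_def s less_imp_le)
  qed
  have "complex_of_real a = braket x (verification_operator m n S *\<^sub>v x)"
    unfolding eig by (simp add: braket_smult_right x(2))
  also have "\<dots> = (\<Sum>M\<leftarrow>map (\<lambda>(p, t). complex_of_real p \<cdot>\<^sub>m test_projector m n t) S. braket x (M *\<^sub>v x))"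
    unfolding verification_operator_def by (rule braket_msum[OF _ x(1)]) auto
  finally have "a = (\<Sum>s\<leftarrow>S. fst s * Re (braket x (test_projector m n (snd s) *\<^sub>v x)))"
    using x(1) by (subst (asm) complex_eq_iff)
      (simp add: Re_sum_list comp_def case_prod_beta smult_mat_mult_vec[of _ "m * n" "m * n"] braket_smult_right)
  moreover have "sum_list (map f S) = sum_list (map fst S) -
      (\<Sum>s\<leftarrow>S. fst s * Re (braket x (test_projector m n (snd s) *\<^sub>v x)))"
    by (simp add: f_def right_diff_distrib sum_list_subtractf)
  ultimately have "sum_list (map f S) \<le> 0"
    using S a by (simp add: state_verification_protocol_def)
  then have "f (p, t) = 0" using sum_list_eq_0D[of S f "(p, t)"] f_nonneg t by blast
  then have "Re (braket x (test_projector m n t *\<^sub>v x)) = 1" using pos[OF t] by (simp add: f_def)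
  then show ?thesis using x by (intro projector_fixes[OF proj[OF t]]) auto
qed

lemma ordinary_strategyI:
  assumes S: "state_verification_protocol m n \<phi> S" and mn: "m * n \<ge> 2" and \<phi>: "\<phi> \<in> carrier_vec (m * n)"
    and unique: "\<And>x. x \<in> carrier_vec (m * n) \<Longrightarrow>
      (\<And>p t. (p, t) \<in> set S \<Longrightarrow> test_projector m n t *\<^sub>v x = x) \<Longrightarrow> \<exists>\<gamma>. x = \<gamma> \<cdot>\<^sub>v \<phi>"
  shows "ordinary_strategy m n S"
proof -
  let ?\<Omega> = "verification_operator m n S"
  have \<Omega>: "?\<Omega> \<in> carrier_mat (m * n) (m * n)"
    unfolding verification_operator_def by (rule msum_carrier) auto
  have "hermitian (test_projector m n t)" if "(p, t) \<in> set S" for p t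
    using that S projector_test_projector[of m n t] by (auto simp: state_verification_protocol_def projector_def)
  then have herm: "hermitian ?\<Omega>"
    unfolding verification_operator_def by (intro hermitian_msum) (auto intro: hermitian_smult_of_real)
  have "second_eigenvalue ?\<Omega> < 1"
  proof (rule second_eigenvalue_less[OF \<Omega> herm mn])
    fix x y a b
    assume x: "x \<in> carrier_vec (m * n)" "braket x x = 1" "?\<Omega> *\<^sub>v x = complex_of_real a \<cdot>\<^sub>v x" "1 \<le> a"
      and y: "y \<in> carrier_vec (m * n)" "braket y y = 1" "?\<Omega> *\<^sub>v y = complex_of_real b \<cdot>\<^sub>v y" "1 \<le> b"
      and xy: "braket x y = 0"
    have "\<exists>\<gamma>. x = \<gamma> \<cdot>\<^sub>v \<phi>"
      by (rule unique[OF x(1)]) (rule verification_operator_eigenvector_fixed[OF S x])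
    moreover have "\<exists>\<delta>. y = \<delta> \<cdot>\<^sub>v \<phi>"
      by (rule unique[OF y(1)]) (rule verification_operator_eigenvector_fixed[OF S y])
    ultimately obtain \<gamma> \<delta> where "x = \<gamma> \<cdot>\<^sub>v \<phi>" "y = \<delta> \<cdot>\<^sub>v \<phi>" by blast
    then show False using x(2) y(2) xy \<phi> by (auto simp: braket_smult_left[of _ "m * n"] braket_smult_right)
  qed
  then show ?thesis by (simp add: ordinary_strategy_def spectral_gap_def)
qed

lemma two_test_strategy_exists:
  assumes \<phi>: "unit_vec (m * n) \<phi>" and mn: "m * n \<ge> 2"
  shows "\<exists>S. state_verification_protocol m n \<phi> S \<and> ordinary_strategy m n S \<and> length S = 2 \<and>
    (\<forall>x\<in>carrier_vec (m * n). (\<forall>(p, t)\<in>set S. test_projector m n t *\<^sub>v x = x) \<longrightarrow> (\<exists>\<gamma>. x = \<gamma> \<cdot>\<^sub>v \<phi>))"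
proof -
  have \<phi>c: "\<phi> \<in> carrier_vec (m * n)" "braket \<phi> \<phi> = 1" using \<phi> by (auto simp: unit_vec_def)
  then have "\<phi> \<noteq> 0\<^sub>v (m * n)" by auto
  from two_tests_exist[OF \<phi>c(1) this] obtain t1 t2 where
    t: "valid_test m n t1" "valid_test m n t2"
      "test_projector m n t1 *\<^sub>v \<phi> = \<phi>" "test_projector m n t2 *\<^sub>v \<phi> = \<phi>"
    and unique: "\<And>x. x \<in> carrier_vec (m * n) \<Longrightarrow> test_projector m n t1 *\<^sub>v x = x \<Longrightarrow>
      test_projector m n t2 *\<^sub>v x = x \<Longrightarrow> \<exists>\<gamma>. x = \<gamma> \<cdot>\<^sub>v \<phi>"
    by blast
  define S :: strategy where "S = [(1 / 2, t1), (1 / 2, t2)]"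
  have S: "state_verification_protocol m n \<phi> S"
    using t \<phi>c by (simp add: state_verification_protocol_def S_def)
  have unique': "\<exists>\<gamma>. x = \<gamma> \<cdot>\<^sub>v \<phi>" if "x \<in> carrier_vec (m * n)"
    "\<And>p t. (p, t) \<in> set S \<Longrightarrow> test_projector m n t *\<^sub>v x = x" for x
    by (rule unique[OF that(1)]) (rule that(2)[of "1 / 2"], simp add: S_def)+
  have "ordinary_strategy m n S" by (rule ordinary_strategyI[OF S mn \<phi>c(1) unique'])
  moreover have "length S = 2" by (simp add: S_def)
  ultimately show ?thesis using S unique' by (intro exI[of _ S]) blast
qed

subsection \<open>Kraus channels\<close>

lemma unitary_mult_vec_braket:
  assumes "unitary n U" "u \<in> carrier_vec n" "v \<in> carrier_vec n"
  shows "braket (U *\<^sub>v u) (U *\<^sub>v v) = braket u v"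
proof -
  have U: "U \<in> carrier_mat n n" "dagger U * U = 1\<^sub>m n" using assms(1) by (auto simp: unitary_def)
  have "braket (U *\<^sub>v u) (U *\<^sub>v v) = braket (dagger U *\<^sub>v (U *\<^sub>v u)) v"
    using U assms by (intro braket_mult_mat_right) auto
  also have "dagger U *\<^sub>v (U *\<^sub>v u) = u"
    using U assms assoc_mult_mat_vec[of "dagger U" n n U n u] by simp
  finally show ?thesis .
qed

lemma unitary_mult:
  assumes "unitary n U" "unitary n V"
  shows "unitary n (U * V)"
proof -
  have U: "U \<in> carrier_mat n n" "dagger U * U = 1\<^sub>m n" and V: "V \<in> carrier_mat n n" "dagger V * V = 1\<^sub>m n"
    using assms by (auto simp: unitary_def)
  have "dagger (U * V) * (U * V) = dagger V * (dagger U * (U * V))"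
    using U V assoc_mult_mat[of "dagger V" n n "dagger U" n "U * V" n] by (simp add: dagger_mult[of _ n n])
  also have "dagger U * (U * V) = V"
    using U V assoc_mult_mat[of "dagger U" n n U n V n] by simp
  finally have "dagger (U * V) * (U * V) = 1\<^sub>m n" using V by simp
  then show ?thesis using mat_mult_left_right_inverse[of "dagger (U * V)" n "U * V"] U V
    by (simp add: unitary_def)
qed

lemma unitary_kraus_channel:
  assumes "unitary n K"
  shows "kraus_channel n [K]"
  using assms by (simp add: kraus_channel_def unitary_def msum_def)

lemma apply_channel_ketbra:
  assumes "\<And>K. K \<in> set Ks \<Longrightarrow> K \<in> carrier_mat n n" "\<psi> \<in> carrier_vec n"
  shows "apply_channel n Ks (ketbra \<psi>) = msum n (map (\<lambda>K. ketbra (K *\<^sub>v \<psi>)) Ks)"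
  unfolding apply_channel_def using assms by (intro arg_cong[of _ _ "msum n"] map_cong refl conj_ketbra) auto

lemma mtrace_mult_apply_channel:
  assumes "\<And>K. K \<in> set Ks \<Longrightarrow> K \<in> carrier_mat n n" "\<psi> \<in> carrier_vec n" "P \<in> carrier_mat n n"
  shows "mtrace (P * apply_channel n Ks (ketbra \<psi>)) = (\<Sum>K\<leftarrow>Ks. braket (K *\<^sub>v \<psi>) (P *\<^sub>v (K *\<^sub>v \<psi>)))"
proof -
  have K\<psi>: "K *\<^sub>v \<psi> \<in> carrier_vec n" if "K \<in> set Ks" for K
    by (rule mult_mat_vec_carrier[OF assms(1)[OF that] assms(2)])
  have "mtrace (P * apply_channel n Ks (ketbra \<psi>)) = mtrace (msum n (map (\<lambda>K. P * ketbra (K *\<^sub>v \<psi>)) Ks))"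
  proof -
    have "P * msum n (map (\<lambda>K. ketbra (K *\<^sub>v \<psi>)) Ks) =
        msum n (map (\<lambda>M. P * M) (map (\<lambda>K. ketbra (K *\<^sub>v \<psi>)) Ks))"
      by (rule mult_msum[OF assms(3)]) (auto simp: K\<psi>)
    then show ?thesis by (subst apply_channel_ketbra[of Ks n \<psi>]) (auto simp: assms comp_def)
  qed
  also have "\<dots> = (\<Sum>K\<leftarrow>Ks. mtrace (P * ketbra (K *\<^sub>v \<psi>)))"
    using assms(3) K\<psi> by (subst mtrace_msum[of _ n]) (auto simp: comp_def intro!: mult_carrier_mat)
  also have "\<dots> = (\<Sum>K\<leftarrow>Ks. braket (K *\<^sub>v \<psi>) (P *\<^sub>v (K *\<^sub>v \<psi>)))"
    using mtrace_mult_ketbra[OF assms(3) K\<psi>] by (intro arg_cong[of _ _ sum_list] map_cong) auto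
  finally show ?thesis .
qed

lemma kraus_channel_braket:
  assumes "kraus_channel n Ks" "u \<in> carrier_vec n" "v \<in> carrier_vec n"
  shows "(\<Sum>K\<leftarrow>Ks. braket (K *\<^sub>v u) (K *\<^sub>v v)) = braket u v"
proof -
  have K: "K \<in> carrier_mat n n" if "K \<in> set Ks" for K using assms(1) that by (simp add: kraus_channel_def)
  have "braket u v = braket u (msum n (map (\<lambda>K. dagger K * K) Ks) *\<^sub>v v)"
    using assms by (simp add: kraus_channel_def)
  also have "\<dots> = (\<Sum>M\<leftarrow>map (\<lambda>K. dagger K * K) Ks. braket u (M *\<^sub>v v))"
    using assms(3) by (intro braket_msum[of _ n]) (auto intro!: mult_carrier_mat[OF dagger_carrier[OF K] K])
  also have "\<dots> = (\<Sum>K\<leftarrow>Ks. braket u ((dagger K * K) *\<^sub>v v))" by (simp add: comp_def)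
  also have "\<dots> = (\<Sum>K\<leftarrow>Ks. braket (K *\<^sub>v u) (K *\<^sub>v v))"
  proof (intro arg_cong[of _ _ sum_list] map_cong refl)
    fix K assume "K \<in> set Ks"
    then have "K \<in> carrier_mat n n" by (rule K)
    then show "braket u (dagger K * K *\<^sub>v v) = braket (K *\<^sub>v u) (K *\<^sub>v v)"
      using assms braket_mult_mat_right[of "dagger K" n n u "K *\<^sub>v v"]
      by (simp add: assoc_mult_mat_vec[of _ n n _ n])
  qed
  finally show ?thesis by simp
qed

lemma kraus_channel_pass_fixed:
  assumes Ks: "kraus_channel n Ks" and \<psi>: "unit_vec n \<psi>" and P: "projector n P"
    and pass: "mtrace (P * apply_channel n Ks (ketbra \<psi>)) = 1" and K: "K \<in> set Ks"
  shows "P *\<^sub>v (K *\<^sub>v \<psi>) = K *\<^sub>v \<psi>"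
proof -
  have \<psi>c: "\<psi> \<in> carrier_vec n" "braket \<psi> \<psi> = 1" using \<psi> by (auto simp: unit_vec_def)
  have Kc: "K \<in> carrier_mat n n" if "K \<in> set Ks" for K using Ks that by (simp add: kraus_channel_def)
  define f where "f K = Re (braket (K *\<^sub>v \<psi>) (K *\<^sub>v \<psi>)) - Re (braket (K *\<^sub>v \<psi>) (P *\<^sub>v (K *\<^sub>v \<psi>)))" for K
  have f_nonneg: "f K \<ge> 0" if "K \<in> set Ks" for K
    using braket_projector_le[OF P, of "K *\<^sub>v \<psi>"] Kc[OF that] \<psi>c by (simp add: f_def)
  have "sum_list (map f Ks) = Re (\<Sum>K\<leftarrow>Ks. braket (K *\<^sub>v \<psi>) (K *\<^sub>v \<psi>)) -
      Re (\<Sum>K\<leftarrow>Ks. braket (K *\<^sub>v \<psi>) (P *\<^sub>v (K *\<^sub>v \<psi>)))"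
    by (simp add: f_def[abs_def] Re_sum_list comp_def sum_list_subtractf)
  also have "\<dots> = 0"
    using kraus_channel_braket[OF Ks \<psi>c(1) \<psi>c(1)] \<psi>c pass
      mtrace_mult_apply_channel[OF Kc \<psi>c(1) projector_carrier[OF P]] by simp
  finally have "f K = 0" using sum_list_eq_0D[of Ks f K] f_nonneg K by simp
  then show ?thesis using Kc[OF K] \<psi>c by (intro projector_fixes[OF P]) (auto simp: f_def)
qed

subsection \<open>Bounds on the number of settings\<close>

lemma unitary_reflection:
  assumes w: "w \<in> carrier_vec n"
  shows "unitary n (1\<^sub>m n - 2 \<cdot>\<^sub>m proj_onto w)"
proof -
  define T where "T = 2 \<cdot>\<^sub>m proj_onto w"
  have P: "proj_onto w \<in> carrier_mat n n" "dagger (proj_onto w) = proj_onto w" "proj_onto w * proj_onto w = proj_onto w"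
    using projector_proj_onto[OF w] by (auto simp: projector_def hermitian_def)
  have T: "T \<in> carrier_mat n n" using P by (simp add: T_def)
  have "dagger T = 2 \<cdot>\<^sub>m dagger (proj_onto w)" unfolding T_def by (intro eq_matI) auto
  then have dT: "dagger T = T" using P(2) by (simp add: T_def)
  have TT: "T * T = 2 \<cdot>\<^sub>m T"
    using P by (simp add: T_def mult_smult_distrib[of _ n n _ n] mult_smult_assoc_mat[of _ n n _ n])
  have "dagger (1\<^sub>m n - T) = dagger (1\<^sub>m n) - dagger T" using T by (intro eq_matI) auto
  also have "dagger (1\<^sub>m n) = 1\<^sub>m n" by (intro eq_matI) auto
  finally have "dagger (1\<^sub>m n - T) = 1\<^sub>m n - T" by (simp add: dT)
  moreover have "(1\<^sub>m n - T) * (1\<^sub>m n - T) = 1\<^sub>m n"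
  proof -
    have "(1\<^sub>m n - T) * (1\<^sub>m n - T) = (1\<^sub>m n - T) * 1\<^sub>m n - (1\<^sub>m n - T) * T"
      using T by (intro mult_minus_distrib_mat) auto
    also have "(1\<^sub>m n - T) * T = 1\<^sub>m n * T - T * T"
      using T by (intro minus_mult_distrib_mat) auto
    finally show ?thesis using T unfolding TT by (auto intro!: eq_matI)
  qed
  ultimately show ?thesis using T unfolding unitary_def T_def[symmetric] by auto
qed

lemma not_verifies_reliably:
  assumes U: "unitary (m * n) U" and Pr: "unitary_verification_protocol m n U Pr"
    and w: "w \<in> carrier_vec (m * n)" "w \<noteq> 0\<^sub>v (m * n)"
    and z: "z \<in> carrier_vec (m * n)" "z \<noteq> 0\<^sub>v (m * n)" and wz: "braket w z = 0"
    and inputs: "\<And>\<psi> S. (\<psi>, S) \<in> set Pr \<Longrightarrow> \<psi> \<in> carrier_vec (m * n) \<and> braket w \<psi> = 0"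
  shows "\<not> verifies_reliably m n U Pr"
proof
  let ?d = "m * n"
  assume rel: "verifies_reliably m n U Pr"
  define V where "V = 1\<^sub>m ?d - 2 \<cdot>\<^sub>m proj_onto w"
  have uV: "unitary ?d V" unfolding V_def by (rule unitary_reflection[OF w(1)])
  have V: "V \<in> carrier_mat ?d ?d" and Uc: "U \<in> carrier_mat ?d ?d" using uV U by (auto simp: unitary_def)
  have Vx: "V *\<^sub>v x = x - 2 \<cdot>\<^sub>v (proj_onto w *\<^sub>v x)" if "x \<in> carrier_vec ?d" for x
    using that w by (simp add: V_def minus_mult_distrib_mat_vec[of _ ?d ?d] smult_mat_mult_vec[of _ ?d ?d])
  have V_fix: "V *\<^sub>v x = x" if x: "x \<in> carrier_vec ?d" "braket w x = 0" for x
    using x w by (simp add: Vx proj_onto_mult_vec[of _ ?d]) (auto intro!: eq_vecI)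
  have V_w: "V *\<^sub>v w = - 1 \<cdot>\<^sub>v w" unfolding Vx[OF w(1)] proj_onto_fixes[OF w(1)] by (auto intro!: eq_vecI)
  define K where "K = U * V"
  have uK: "unitary ?d K" unfolding K_def by (rule unitary_mult[OF U uV])
  have K: "K \<in> carrier_mat ?d ?d" using uK by (simp add: unitary_def)
  have K_fix: "K *\<^sub>v x = U *\<^sub>v x" if "x \<in> carrier_vec ?d" "braket w x = 0" for x
    using that Uc V by (simp add: K_def assoc_mult_mat_vec[of _ ?d ?d _ ?d] V_fix)
  have K_w: "K *\<^sub>v w = - 1 \<cdot>\<^sub>v (U *\<^sub>v w)"
    using Uc V w by (simp add: K_def assoc_mult_mat_vec[of _ ?d ?d _ ?d] V_w mult_mat_vec[of _ ?d ?d])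
  have "passes_with_certainty m n [K] \<psi> S" if \<psi>S: "(\<psi>, S) \<in> set Pr" for \<psi> S
    unfolding passes_with_certainty_def
  proof clarify
    fix p As Bs A assume "(p, (As, Bs), A) \<in> set S"
    then obtain t where t: "t = ((As, Bs), A)" "(p, t) \<in> set S" by blast
    have "braket (U *\<^sub>v \<psi>) (test_projector m n t *\<^sub>v (U *\<^sub>v \<psi>)) = 1"
      using Pr \<psi>S t(2) by (fastforce simp: unitary_verification_protocol_def state_verification_protocol_def)
    then show "mtrace (test_projector m n ((As, Bs), A) * apply_channel ?d [K] (ketbra \<psi>)) = 1"
      using inputs[OF \<psi>S] K by (subst mtrace_mult_apply_channel) (auto simp: K_fix t(1))
  qed
  then have "\<forall>\<rho>\<in>carrier_mat ?d ?d. apply_channel ?d [K] \<rho> = U * \<rho> * dagger U"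
    using rel unitary_kraus_channel[OF uK] unfolding verifies_reliably_def by blast
  then have "apply_channel ?d [K] (outer w z) = U * outer w z * dagger U" using w z by simp
  moreover have "L * outer w z * dagger L = outer (L *\<^sub>v w) (L *\<^sub>v z)" if "L \<in> carrier_mat ?d ?d" for L
    using that w z by (subst mult_outer[of _ ?d ?d _ _ ?d]) (auto intro!: outer_mult_dagger[of _ ?d ?d _ ?d])
  moreover have "apply_channel ?d [K] (outer w z) = K * outer w z * dagger K"
    using K w z by (auto simp: apply_channel_def msum_def)
  ultimately have eq: "outer (- 1 \<cdot>\<^sub>v (U *\<^sub>v w)) (U *\<^sub>v z) = outer (U *\<^sub>v w) (U *\<^sub>v z)"
    using K Uc K_fix[OF z(1) wz] K_w by simp
  have nonzero: "\<exists>i<?d. (U *\<^sub>v x) $ i \<noteq> 0" if x: "x \<in> carrier_vec ?d" "x \<noteq> 0\<^sub>v ?d" for x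
  proof (rule ccontr)
    assume "\<not> ?thesis"
    then have "U *\<^sub>v x = 0\<^sub>v ?d" using Uc by (intro eq_vecI) (auto simp del: index_mult_mat_vec)
    then have "braket x x = 0" using unitary_mult_vec_braket[OF U x(1) x(1)] by simp
    then show False using braket_self_eq_0_iff[OF x(1)] x(2) by simp
  qed
  obtain i j where ij: "i < ?d" "(U *\<^sub>v w) $ i \<noteq> 0" "j < ?d" "(U *\<^sub>v z) $ j \<noteq> 0"
    using nonzero[OF w] nonzero[OF z] by blast
  from eq have "outer (- 1 \<cdot>\<^sub>v (U *\<^sub>v w)) (U *\<^sub>v z) $$ (i, j) = outer (U *\<^sub>v w) (U *\<^sub>v z) $$ (i, j)" by simp
  then show False using ij Uc by (simp add: outer_def del: index_mult_mat_vec)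
qed

lemma finite_settings: "finite (\<Union>(\<psi>, S)\<in>set Pr. (\<lambda>(p, t). (\<psi>, fst t)) ` set S)"
  by auto

lemma card_inputs_le_num_settings:
  assumes "unitary_verification_protocol m n U Pr"
  shows "card (fst ` set Pr) \<le> num_settings Pr"
proof -
  let ?X = "\<Union>(\<psi>, S)\<in>set Pr. (\<lambda>(p, t). (\<psi>, fst t)) ` set S"
  have "fst ` set Pr \<subseteq> fst ` ?X"
  proof
    fix \<psi> assume "\<psi> \<in> fst ` set Pr"
    then obtain S where S: "(\<psi>, S) \<in> set Pr" by auto
    then have "S \<noteq> []"
      using assms by (fastforce simp: unitary_verification_protocol_def state_verification_protocol_def)
    then obtain s where s: "s \<in> set S" by (cases S) auto
    then have "(\<psi>, fst (snd s)) \<in> ?X" using S by (force simp: case_prod_beta)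
    then show "\<psi> \<in> fst ` ?X" by force
  qed
  then have "card (fst ` set Pr) \<le> card (fst ` ?X)" by (intro card_mono finite_imageI finite_settings)
  also have "\<dots> \<le> card ?X" by (intro card_image_le finite_settings)
  finally show ?thesis by (simp add: num_settings_def)
qed

lemma num_settings_ge:
  assumes U: "unitary (m * n) U" and Pr: "unitary_verification_protocol m n U Pr"
    and rel: "verifies_reliably m n U Pr" and mn: "m * n \<ge> 2"
  shows "m * n \<le> num_settings Pr"
proof (rule ccontr)
  assume "\<not> m * n \<le> num_settings Pr"
  then have less: "card (fst ` set Pr) < m * n" using card_inputs_le_num_settings[OF Pr] by simp
  have inputs: "\<psi> \<in> carrier_vec (m * n)" if "\<psi> \<in> fst ` set Pr" for \<psi>
  proof -
    have "pure_product_state m n \<psi>" using that Pr by (fastforce simp: unitary_verification_protocol_def)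
    then show ?thesis by (auto simp: pure_product_state_def unit_vec_def)
  qed
  obtain v where v: "bij_betw v {0..<card (fst ` set Pr)} (fst ` set Pr)"
    using ex_bij_betw_nat_finite[of "fst ` set Pr"] by auto
  obtain w where w: "w \<in> carrier_vec (m * n)" "w \<noteq> 0\<^sub>v (m * n)"
    "\<forall>i<card (fst ` set Pr). braket (v i) w = 0"
    using exists_orthogonal_vec[OF less, of v] inputs bij_betwE[OF v] by auto
  have orth: "braket w \<psi> = 0" if \<psi>: "\<psi> \<in> fst ` set Pr" for \<psi>
  proof -
    have "\<psi> \<in> v ` {0..<card (fst ` set Pr)}" using v \<psi> by (simp add: bij_betw_def)
    then have "braket \<psi> w = 0" using w(3) by auto
    then show ?thesis using cnj_braket[OF inputs[OF \<psi>] w(1)] by simp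
  qed
  obtain z where z: "z \<in> carrier_vec (m * n)" "z \<noteq> 0\<^sub>v (m * n)" "braket w z = 0"
    using exists_orthogonal_vec[of 1 "m * n" "\<lambda>_. w"] w(1) mn by auto
  have "\<not> verifies_reliably m n U Pr"
    using inputs orth by (intro not_verifies_reliably[OF U Pr w(1,2) z]) force
  then show False using rel by contradiction
qed

lemma msum_smult:
  assumes "M \<in> carrier_mat n n"
  shows "msum n (map (\<lambda>x. f x \<cdot>\<^sub>m M) xs) = (\<Sum>x\<leftarrow>xs. f x) \<cdot>\<^sub>m M"
proof (induction xs)
  case Nil
  show ?case using assms by (auto simp: msum_def intro!: eq_matI)
next
  case (Cons x xs)
  then show ?case using assms by (simp add: msum_Cons add_smult_distrib_right_mat[of _ n n])
qed

lemma kraus_channel_eq_unitary_channel: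
  assumes U: "unitary n U" and Ks: "kraus_channel n Ks" and N: "N > 0"
    and \<psi>: "\<And>j. j < N \<Longrightarrow> \<psi> j \<in> carrier_vec n" "\<And>j. j < N \<Longrightarrow> braket (\<psi> j) (\<psi> j) = 1"
    and overlap: "\<And>j. j < N \<Longrightarrow> braket (\<psi> 0) (\<psi> j) \<noteq> 0"
    and separating: "\<And>A. A \<in> carrier_mat n n \<Longrightarrow> (\<And>j. j < N \<Longrightarrow> A *\<^sub>v \<psi> j = 0\<^sub>v n) \<Longrightarrow> A = 0\<^sub>m n n"
    and proportional: "\<And>K j. K \<in> set Ks \<Longrightarrow> j < N \<Longrightarrow> \<exists>\<gamma>. K *\<^sub>v \<psi> j = \<gamma> \<cdot>\<^sub>v (U *\<^sub>v \<psi> j)"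
    and \<rho>: "\<rho> \<in> carrier_mat n n"
  shows "apply_channel n Ks \<rho> = U * \<rho> * dagger U"
proof -
  have Uc: "U \<in> carrier_mat n n" using U by (simp add: unitary_def)
  have Kc: "K \<in> carrier_mat n n" if "K \<in> set Ks" for K using Ks that by (simp add: kraus_channel_def)
  obtain \<gamma> where \<gamma>: "\<And>K j. K \<in> set Ks \<Longrightarrow> j < N \<Longrightarrow> K *\<^sub>v \<psi> j = \<gamma> K j \<cdot>\<^sub>v (U *\<^sub>v \<psi> j)"
    using proportional by metis
  have corr: "(\<Sum>K\<leftarrow>Ks. cnj (\<gamma> K i) * \<gamma> K j) = 1" if ij: "i < N" "j < N" and ne: "braket (\<psi> i) (\<psi> j) \<noteq> 0" for i j
  proof -
    have "braket (\<psi> i) (\<psi> j) = (\<Sum>K\<leftarrow>Ks. braket (K *\<^sub>v \<psi> i) (K *\<^sub>v \<psi> j))"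
      by (rule kraus_channel_braket[OF Ks \<psi>(1)[OF ij(1)] \<psi>(1)[OF ij(2)], symmetric])
    also have "\<dots> = (\<Sum>K\<leftarrow>Ks. cnj (\<gamma> K i) * \<gamma> K j * braket (\<psi> i) (\<psi> j))"
    proof (intro arg_cong[of _ _ sum_list] map_cong refl)
      fix K assume K: "K \<in> set Ks"
      have "braket (K *\<^sub>v \<psi> i) (K *\<^sub>v \<psi> j) = cnj (\<gamma> K i) * (\<gamma> K j * braket (U *\<^sub>v \<psi> i) (U *\<^sub>v \<psi> j))"
        using braket_smult_left[of "U *\<^sub>v \<psi> i" n "\<gamma> K j \<cdot>\<^sub>v (U *\<^sub>v \<psi> j)" "\<gamma> K i"] Uc \<psi>(1) ij
        by (simp add: \<gamma>[OF K] braket_smult_right)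
      then show "braket (K *\<^sub>v \<psi> i) (K *\<^sub>v \<psi> j) = cnj (\<gamma> K i) * \<gamma> K j * braket (\<psi> i) (\<psi> j)"
        by (simp add: unitary_mult_vec_braket[OF U \<psi>(1)[OF ij(1)] \<psi>(1)[OF ij(2)]])
    qed
    also have "\<dots> = (\<Sum>K\<leftarrow>Ks. cnj (\<gamma> K i) * \<gamma> K j) * braket (\<psi> i) (\<psi> j)"
      by (simp add: sum_list_mult_const)
    finally show ?thesis using ne by simp
  qed
  have \<gamma>_const: "\<gamma> K j = \<gamma> K 0" if K: "K \<in> set Ks" and j: "j < N" for K j
  proof -
    define f where "f K = (cmod (\<gamma> K j - \<gamma> K 0))\<^sup>2" for K
    have "braket (\<psi> j) (\<psi> 0) \<noteq> 0"
      using overlap[OF j] cnj_braket[OF \<psi>(1)[OF N] \<psi>(1)[OF j]] by (metis complex_cnj_zero_iff)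
    then have s: "(\<Sum>K\<leftarrow>Ks. cnj (\<gamma> K j) * \<gamma> K j) = 1" "(\<Sum>K\<leftarrow>Ks. cnj (\<gamma> K j) * \<gamma> K 0) = 1"
      "(\<Sum>K\<leftarrow>Ks. cnj (\<gamma> K 0) * \<gamma> K j) = 1" "(\<Sum>K\<leftarrow>Ks. cnj (\<gamma> K 0) * \<gamma> K 0) = 1"
      using corr[OF j j] corr[OF j N] corr[OF N j] corr[OF N N] overlap[OF j] \<psi>(2)[OF j] \<psi>(2)[OF N] by simp_all
    have fK: "complex_of_real (f K) = cnj (\<gamma> K j) * \<gamma> K j - cnj (\<gamma> K j) * \<gamma> K 0 -
        (cnj (\<gamma> K 0) * \<gamma> K j - cnj (\<gamma> K 0) * \<gamma> K 0)" for K
      unfolding f_def complex_norm_square by (simp add: algebra_simps)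
    have "complex_of_real (sum_list (map f Ks)) = (\<Sum>K\<leftarrow>Ks. complex_of_real (f K))"
      by (induction Ks) auto
    also have "\<dots> = 0" unfolding fK sum_list_subtractf s by simp
    finally have "sum_list (map f Ks) \<le> 0" by simp
    then have "f K = 0" using sum_list_eq_0D[of Ks f K] K by (simp add: f_def)
    then show ?thesis by (simp add: f_def)
  qed
  have K_eq: "K = \<gamma> K 0 \<cdot>\<^sub>m U" if K: "K \<in> set Ks" for K
  proof -
    have "K - \<gamma> K 0 \<cdot>\<^sub>m U = 0\<^sub>m n n"
    proof (rule separating)
      fix j assume j: "j < N"
      show "(K - \<gamma> K 0 \<cdot>\<^sub>m U) *\<^sub>v \<psi> j = 0\<^sub>v n"
        using Kc[OF K] Uc \<psi>(1)[OF j]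
        by (simp add: minus_mult_distrib_mat_vec[of _ n n] smult_mat_mult_vec[of _ n n] \<gamma>[OF K j] \<gamma>_const[OF K j])
    qed (use Kc[OF K] Uc in auto)
    then have "(K - \<gamma> K 0 \<cdot>\<^sub>m U) $$ (i, j) = 0" if "i < n" "j < n" for i j using that by simp
    then show ?thesis using Kc[OF K] Uc by (intro eq_matI) auto
  qed
  define M where "M = U * \<rho> * dagger U"
  have M: "M \<in> carrier_mat n n"
    unfolding M_def by (intro mult_carrier_mat[of _ n n] dagger_carrier Uc \<rho>)
  have "K * \<rho> * dagger K = (cnj (\<gamma> K 0) * \<gamma> K 0) \<cdot>\<^sub>m M" if "K \<in> set Ks" for K
  proof -
    have "K * \<rho> * dagger K = (\<gamma> K 0 \<cdot>\<^sub>m U) * \<rho> * dagger (\<gamma> K 0 \<cdot>\<^sub>m U)"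
      using K_eq[OF that] by (rule subst) (rule refl)
    also have "dagger (\<gamma> K 0 \<cdot>\<^sub>m U) = cnj (\<gamma> K 0) \<cdot>\<^sub>m dagger U" by (intro eq_matI) auto
    also have "(\<gamma> K 0 \<cdot>\<^sub>m U) * \<rho> = \<gamma> K 0 \<cdot>\<^sub>m (U * \<rho>)"
      using Uc \<rho> by (rule mult_smult_assoc_mat)
    also have "\<gamma> K 0 \<cdot>\<^sub>m (U * \<rho>) * (cnj (\<gamma> K 0) \<cdot>\<^sub>m dagger U) = \<gamma> K 0 \<cdot>\<^sub>m (cnj (\<gamma> K 0) \<cdot>\<^sub>m M)"
      unfolding M_def mult_smult_distrib[OF mult_carrier_mat[OF Uc \<rho>] dagger_carrier[OF Uc]]
        mult_smult_assoc_mat[OF mult_carrier_mat[OF Uc \<rho>] smult_carrier_mat[OF dagger_carrier[OF Uc]]] ..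
    also have "\<dots> = (cnj (\<gamma> K 0) * \<gamma> K 0) \<cdot>\<^sub>m M" by (intro eq_matI) auto
    finally show ?thesis .
  qed
  then have "apply_channel n Ks \<rho> = msum n (map (\<lambda>K. (cnj (\<gamma> K 0) * \<gamma> K 0) \<cdot>\<^sub>m M) Ks)"
    unfolding apply_channel_def by (intro arg_cong[of _ _ "msum n"] map_cong) auto
  also have "\<dots> = (\<Sum>K\<leftarrow>Ks. cnj (\<gamma> K 0) * \<gamma> K 0) \<cdot>\<^sub>m M" by (rule msum_smult[OF M])
  also have "(\<Sum>K\<leftarrow>Ks. cnj (\<gamma> K 0) * \<gamma> K 0) = 1" using corr[OF N N] \<psi>(2)[OF N] by simp
  also have "1 \<cdot>\<^sub>m M = M" by (intro eq_matI) auto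
  finally show ?thesis by (simp only: M_def)
qed

definition overlapping_basis :: "nat \<Rightarrow> nat \<Rightarrow> complex vec" where
  "overlapping_basis n j = vec n (\<lambda>a. if j = 0 then (if a = 0 then 1 else 0)
     else (if a = 0 \<or> a = j then complex_of_real (1 / sqrt 2) else 0))"

lemma overlapping_basis_carrier [simp]: "overlapping_basis n j \<in> carrier_vec n"
  by (simp add: overlapping_basis_def)

lemma sum_overlapping_basis:
  assumes "j < n"
  shows "(\<Sum>a<n. g a * overlapping_basis n j $ a) =
    (if j = 0 then g 0 else (g 0 + g j) * complex_of_real (1 / sqrt 2))"
proof (cases "j = 0")
  case True
  then show ?thesis using assms
    by (subst sum.mono_neutral_right[of _ "{0}"]) (auto simp: overlapping_basis_def)
next
  case False
  then show ?thesis using assms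
    by (subst sum.mono_neutral_right[of _ "{0, j}"]) (auto simp: overlapping_basis_def distrib_right add_divide_distrib)
qed

lemma unit_vec_overlapping_basis:
  assumes "j < n"
  shows "unit_vec n (overlapping_basis n j)"
proof -
  have "complex_of_real (1 / sqrt 2) * complex_of_real (1 / sqrt 2) = 1 / 2"
    unfolding of_real_mult[symmetric] by simp
  then have "braket (overlapping_basis n j) (overlapping_basis n j) = 1"
    unfolding braket_eq[OF overlapping_basis_carrier] sum_overlapping_basis[OF assms]
    using assms by (auto simp: overlapping_basis_def distrib_right)
  then show ?thesis by (simp add: unit_vec_def)
qed

lemma braket_overlapping_basis_0:
  assumes "j < n"
  shows "braket (overlapping_basis n 0) (overlapping_basis n j) \<noteq> 0"
  unfolding braket_eq[OF overlapping_basis_carrier] sum_overlapping_basis[OF assms]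
  using assms by (auto simp: overlapping_basis_def)

lemma overlapping_basis_separating:
  assumes "\<And>j. j < n \<Longrightarrow> (\<Sum>a<n. g a * overlapping_basis n j $ a) = 0" "a < n"
  shows "g a = 0"
proof -
  have "g 0 = 0" using assms(1)[of 0] sum_overlapping_basis[of 0 n g] assms(2) by simp
  then show ?thesis using assms(1)[OF assms(2)] sum_overlapping_basis[OF assms(2), of g]
    by (cases "a = 0") auto
qed

lemma kron_overlapping_basis_separating:
  assumes A: "A \<in> carrier_mat l (m * n)"
    and zero: "\<And>j k. j < m \<Longrightarrow> k < n \<Longrightarrow> A *\<^sub>v kron_vec (overlapping_basis m j) (overlapping_basis n k) = 0\<^sub>v l"
  shows "A = 0\<^sub>m l (m * n)"
proof (rule eq_matI)
  fix r i assume "r < dim_row (0\<^sub>m l (m * n))" "i < dim_col (0\<^sub>m l (m * n))"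
  then have r: "r < l" and i: "i < m * n" by auto
  define g where "g a b = A $$ (r, a * n + b)" for a b
  have "(\<Sum>b<n. g a b * overlapping_basis n k $ b) = 0" if a: "a < m" and k: "k < n" for a k
  proof (rule overlapping_basis_separating[where g = "\<lambda>a. \<Sum>b<n. g a b * overlapping_basis n k $ b", OF _ a])
    fix j assume j: "j < m"
    have "0 = (A *\<^sub>v kron_vec (overlapping_basis m j) (overlapping_basis n k)) $ r"
      unfolding zero[OF j k] using r by simp
    also have "\<dots> = (\<Sum>i<m * n. A $$ (r, i) * kron_vec (overlapping_basis m j) (overlapping_basis n k) $ i)"
      by (rule mult_mat_vec_index[OF A _ r]) simp
    also have "\<dots> = (\<Sum>a<m. \<Sum>b<n. A $$ (r, a * n + b) * kron_vec (overlapping_basis m j) (overlapping_basis n k) $ (a * n + b))"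
      by (rule sum_prod_index)
    also have "\<dots> = (\<Sum>a<m. (\<Sum>b<n. g a b * overlapping_basis n k $ b) * overlapping_basis m j $ a)"
      by (intro sum.cong refl) (simp add: g_def kron_vec_index[of _ m _ n] sum_distrib_left mult_ac)
    finally show "(\<Sum>a<m. (\<Sum>b<n. g a b * overlapping_basis n k $ b) * overlapping_basis m j $ a) = 0" by simp
  qed
  then have "g (i div n) (i mod n) = 0"
    using prod_index_decomp[OF i] by (intro overlapping_basis_separating[where g = "g (i div n)"]) auto
  then show "A $$ (r, i) = 0\<^sub>m l (m * n) $$ (r, i)"
    using r i by (simp add: g_def)
qed (use A in auto)

lemma num_settings_le:
  assumes "\<And>\<psi> S. (\<psi>, S) \<in> set Pr \<Longrightarrow> length S \<le> k"
  shows "num_settings Pr \<le> k * length Pr"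
proof -
  define F where "F = (\<lambda>(\<psi> :: complex vec, S :: strategy). (\<lambda>(p, t). (\<psi>, fst t)) ` set S)"
  have F: "card (F x) \<le> k" if "x \<in> set Pr" for x
  proof -
    obtain \<psi> S where x: "x = (\<psi>, S)" by (rule prod.exhaust)
    have "card (F x) \<le> card (set S)" unfolding F_def x by (simp add: card_image_le)
    also have "\<dots> \<le> length S" by (rule card_length)
    finally show ?thesis using assms[of \<psi> S] that x by simp
  qed
  have "num_settings Pr = card (\<Union>x\<in>set Pr. F x)" by (simp add: num_settings_def F_def)
  also have "\<dots> \<le> (\<Sum>x\<in>set Pr. card (F x))" by (intro card_UN_le) simp
  also have "\<dots> \<le> (\<Sum>x\<in>set Pr. k)" using F by (intro sum_mono) auto
  also have "\<dots> \<le> k * length Pr" using card_length[of Pr] by simp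
  finally show ?thesis .
qed

lemma protocol_exists:
  assumes U: "unitary (m * n) U" and mn: "m * n \<ge> 2"
  shows "\<exists>Pr. unitary_verification_protocol m n U Pr \<and> ordinary_protocol m n Pr \<and>
    verifies_reliably m n U Pr \<and> num_settings Pr \<le> 2 * (m * n)"
proof -
  let ?d = "m * n"
  have Uc: "U \<in> carrier_mat ?d ?d" using U by (simp add: unitary_def)
  have pos: "m > 0" "n > 0" using mn by (auto intro!: Nat.gr0I)
  define \<psi> where "\<psi> i = kron_vec (overlapping_basis m (i div n)) (overlapping_basis n (i mod n))" for i
  have \<psi>c: "\<psi> i \<in> carrier_vec ?d" for i by (simp add: \<psi>_def)
  have product: "pure_product_state m n (\<psi> i)" if "i < ?d" for i
    unfolding pure_product_state_def \<psi>_def using prod_index_decomp[OF that] unit_vec_overlapping_basis by blast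
  have \<psi>1: "braket (\<psi> i) (\<psi> i) = 1" if "i < ?d" for i
    using prod_index_decomp[OF that] unit_vec_overlapping_basis[of "i div n" m] unit_vec_overlapping_basis[of "i mod n" n]
    by (simp add: \<psi>_def braket_kron_vec[of _ m _ _ n] unit_vec_def)
  have "unit_vec ?d (U *\<^sub>v \<psi> i)" if "i < ?d" for i
    using Uc \<psi>c[of i] \<psi>1[OF that] unitary_mult_vec_braket[OF U \<psi>c \<psi>c] by (simp add: unit_vec_def)
  then have "\<forall>i. \<exists>S. i < ?d \<longrightarrow> state_verification_protocol m n (U *\<^sub>v \<psi> i) S \<and> ordinary_strategy m n S \<and>
      length S = 2 \<and> (\<forall>x\<in>carrier_vec ?d. (\<forall>(p, t)\<in>set S. test_projector m n t *\<^sub>v x = x) \<longrightarrow>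
        (\<exists>\<gamma>. x = \<gamma> \<cdot>\<^sub>v (U *\<^sub>v \<psi> i)))"
    using two_test_strategy_exists[OF _ mn] by blast
  then obtain S where S: "\<And>i. i < ?d \<Longrightarrow> state_verification_protocol m n (U *\<^sub>v \<psi> i) (S i)"
      "\<And>i. i < ?d \<Longrightarrow> ordinary_strategy m n (S i)" "\<And>i. i < ?d \<Longrightarrow> length (S i) = 2"
    and unique: "\<And>i x. i < ?d \<Longrightarrow> x \<in> carrier_vec ?d \<Longrightarrow>
      (\<forall>(p, t)\<in>set (S i). test_projector m n t *\<^sub>v x = x) \<Longrightarrow> \<exists>\<gamma>. x = \<gamma> \<cdot>\<^sub>v (U *\<^sub>v \<psi> i)"
    by metis
  define Pr where "Pr = map (\<lambda>i. (\<psi> i, S i)) [0..<?d]"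
  have "unitary_verification_protocol m n U Pr"
    using product S by (auto simp: unitary_verification_protocol_def Pr_def)
  moreover have "ordinary_protocol m n Pr" using S by (auto simp: ordinary_protocol_def Pr_def)
  moreover have "verifies_reliably m n U Pr"
    unfolding verifies_reliably_def
  proof (intro allI impI ballI)
    fix Ks and \<rho> :: "complex mat" assume Ks: "kraus_channel ?d Ks"
      and pass: "\<forall>(\<psi>, S)\<in>set Pr. passes_with_certainty m n Ks \<psi> S" and \<rho>: "\<rho> \<in> carrier_mat ?d ?d"
    show "apply_channel ?d Ks \<rho> = U * \<rho> * dagger U"
    proof (rule kraus_channel_eq_unitary_channel[OF U Ks _ \<psi>c \<psi>1 _ _ _ \<rho>])
      show "?d > 0" using pos by simp
      show "braket (\<psi> 0) (\<psi> j) \<noteq> 0" if "j < ?d" for j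
        using prod_index_decomp[OF that]
        by (simp add: \<psi>_def braket_kron_vec[of _ m _ _ n] braket_overlapping_basis_0)
      show "A = 0\<^sub>m ?d ?d" if "A \<in> carrier_mat ?d ?d" "\<And>j. j < ?d \<Longrightarrow> A *\<^sub>v \<psi> j = 0\<^sub>v ?d" for A
      proof (rule kron_overlapping_basis_separating[OF that(1)])
        fix j k assume "j < m" "k < n"
        then show "A *\<^sub>v kron_vec (overlapping_basis m j) (overlapping_basis n k) = 0\<^sub>v ?d"
          using that(2)[of "j * n + k"] by (simp add: \<psi>_def prod_index)
      qed
      fix K j assume K: "K \<in> set Ks" and j: "j < ?d"
      show "\<exists>\<gamma>. K *\<^sub>v \<psi> j = \<gamma> \<cdot>\<^sub>v (U *\<^sub>v \<psi> j)"
      proof (rule unique[OF j])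
        show "K *\<^sub>v \<psi> j \<in> carrier_vec ?d"
          using Ks K \<psi>c by (auto simp: kraus_channel_def intro: mult_mat_vec_carrier)
        have passj: "passes_with_certainty m n Ks (\<psi> j) (S j)" using pass j by (auto simp: Pr_def)
        show "\<forall>(p, t)\<in>set (S j). test_projector m n t *\<^sub>v (K *\<^sub>v \<psi> j) = K *\<^sub>v \<psi> j"
        proof (rule ballI, rule case_prodI2)
          fix s p t assume s: "s \<in> set (S j)" "s = (p, t)"
          have "valid_test m n t" using S(1)[OF j] s by (auto simp: state_verification_protocol_def)
          moreover have "mtrace (test_projector m n t * apply_channel ?d Ks (ketbra (\<psi> j))) = 1"
            using passj s by (auto simp: passes_with_certainty_def)
          moreover have "unit_vec ?d (\<psi> j)" using \<psi>c \<psi>1[OF j] by (simp add: unit_vec_def)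
          ultimately show "test_projector m n t *\<^sub>v (K *\<^sub>v \<psi> j) = K *\<^sub>v \<psi> j"
            using kraus_channel_pass_fixed[OF Ks _ projector_test_projector _ K] by blast
        qed
      qed
    qed
  qed
  moreover have "num_settings Pr \<le> 2 * length Pr"
    using S(3) by (intro num_settings_le) (auto simp: Pr_def)
  ultimately show ?thesis by (intro exI[of _ Pr]) (simp add: Pr_def)
qed

theorem theorem3:
  fixes dA dB :: nat and U :: "complex mat"
  assumes "dA \<ge> 2" and "dB \<ge> 2"
    and "unitary (dA * dB) U"
  shows "enat (dA * dB) \<le> mu dA dB U \<and> mu dA dB U \<le> enat (2 * (dA * dB))"
proof
  have "2 * 2 \<le> dA * dB" using assms(1,2) by (rule mult_le_mono)
  then have d: "dA * dB \<ge> 2" by simp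
  show "enat (dA * dB) \<le> mu dA dB U"
    unfolding mu_def using num_settings_ge[OF assms(3) _ _ d] by (intro INF_greatest) auto
  obtain Pr where "unitary_verification_protocol dA dB U Pr" "ordinary_protocol dA dB Pr"
    "verifies_reliably dA dB U Pr" "num_settings Pr \<le> 2 * (dA * dB)"
    using protocol_exists[OF assms(3) d] by blast
  then show "mu dA dB U \<le> enat (2 * (dA * dB))"
    unfolding mu_def by (intro INF_lower2[of Pr]) auto
qed

end
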